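(* Let $I$ be a compact real interval and let $g:I\to I$ be a homeomorphism of $I$ into itself (i.e. a continuous injective map, a homeomorphism onto its image $g(I)\subseteq I$). Then the dynamical system $(I,g)$ is a factor of a finite automaton.
   Context: A dynamical system $(X,f)$ is a continuous map $f:X\to X$ of a compact metric space $X$ to itself. $(Y,g)$ is a factor of $(X,f)$ if there is a continuous surjective map $\varphi:X\to Y$ with $g\varphi=\varphi f$. Finite automata. For a finite alphabet $A$ let $A^{\mathbb N}$ be the set of infinite sequences $u=u_0u_1u_2\ldots$ with $u_i\in A$ and metric $2^{-n}$, $n=\inf\{i\ge 0: u_i\ne v_i\}$. Let $\bullet,\sharp$ be symbols not in the alphabets, and define on $A^{\mathbb N}$: $\sigma_\sharp(u_0u_1u_2\ldots)=u_1u_2u_3\ldots$, $\sigma_\bullet(u)=u$, and $\sigma_a(u_0u_1\ldots)=au_0u_1\ldots$ for $a\in A$. Let $T$ be a finite set (of tapes) and for each $t\in T$ let $A_t$ be a finite alphabet. Put $Q=\prod_{t\in T}A_t$, $X=\prod_{t\in T}A_t^{\mathbb N}$ with a product metric, and $\pi:X\to Q$, $\pi(u)_t=u_{t0}$. The automaton with transition functions $f_t:Q\to A_t\cup\{\bullet,\sharp\}$ $(t\in T)$ is the dynamical system $(X,f)$ with $f(u)_t=\sigma_{f_t(\pi(u))}(u_t)$ for $u\in X$, $t\in T$. A tape $t$ is an input tape if $f_t(q)\in\{\bullet,\sharp\}$ for all $q\in Q$, and an output tape if $f_t(q)\in A_t\cup\{\bullet\}$ for all $q\in Q$. The automaton is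 a finite automaton if every tape is an input tape or an output tape. *)

theory Defs
  imports "HOL-Analysis.Analysis"
begin

section \<open>Dynamical systems and factors\<close>

definition dynamical_system :: "'a metric \<Rightarrow> ('a \<Rightarrow> 'a) \<Rightarrow> bool" where
  "dynamical_system X f \<longleftrightarrow>
     compact_space (mtopology_of X) \<and> continuous_map (mtopology_of X) (mtopology_of X) f"

text \<open>\<open>is_factor Y g X f\<close>: the system \<open>(Y, g)\<close> is a factor of the system \<open>(X, f)\<close>.\<close>

definition is_factor :: "'b metric \<Rightarrow> ('b \<Rightarrow> 'b) \<Rightarrow> 'a metric \<Rightarrow> ('a \<Rightarrow> 'a) \<Rightarrow> bool" where
  "is_factor Y g X f \<longleftrightarrow>
     dynamical_system Y g \<and> dynamical_system X f \<and>
     (\<exists>\<phi>. continuous_map (mtopology_of X) (mtopology_of Y) \<phi> \<and>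
          \<phi> ` mspace X = mspace Y \<and>
          (\<forall>x\<in>mspace X. g (\<phi> x) = \<phi> (f x)))"

section \<open>Sequences\<close>

text \<open>For \<open>u \<noteq> v\<close> this is \<open>2\<^sup>-\<^sup>n\<close> with \<open>n\<close> the first position where \<open>u\<close> and \<open>v\<close> differ.\<close>

definition seq_dist :: "(nat \<Rightarrow> 'a) \<Rightarrow> (nat \<Rightarrow> 'a) \<Rightarrow> real" where
  "seq_dist u v = (if u = v then 0 else (1 / 2) ^ (LEAST i. u i \<noteq> v i))"

text \<open>
  A transition function has values in \<open>A\<^sub>t \<union> {\<bullet>, \<sharp>}\<close>. The constructors \<open>Stay\<close> and \<open>Shift\<close>
  stand for \<open>\<bullet>\<close> and \<open>\<sharp>\<close>, and \<open>Push\<close> injects the letters, so that the two extra symbols are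
  outside every alphabet.
\<close>

datatype 'a action = Stay | Shift | Push 'a

fun act :: "'a action \<Rightarrow> (nat \<Rightarrow> 'a) \<Rightarrow> nat \<Rightarrow> 'a" where
  "act Stay u = u"
| "act Shift u = (\<lambda>i. u (Suc i))"
| "act (Push a) u = case_nat a u"

section \<open>Automata\<close>

text \<open>
  A finite set of tapes with finite alphabets can always be coded by natural numbers, so asking
  for an automaton of type \<open>(nat, nat) automaton\<close> loses no generality.
\<close>

record ('t, 'a) automaton =
  tapes :: "'t set"
  alphabet :: "'t \<Rightarrow> 'a set"
  trans :: "'t \<Rightarrow> ('t \<Rightarrow> 'a) \<Rightarrow> 'a action"

definition states :: "('t, 'a) automaton \<Rightarrow> ('t \<Rightarrow> 'a) set" where
  "states M = (\<Pi>\<^sub>E t\<in>tapes M. alphabet M t)"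

definition automaton :: "('t, 'a) automaton \<Rightarrow> bool" where
  "automaton M \<longleftrightarrow>
     finite (tapes M) \<and>
     (\<forall>t\<in>tapes M. finite (alphabet M t)) \<and>
     (\<forall>t\<in>tapes M. \<forall>q\<in>states M. trans M t q \<in> Push ` alphabet M t \<union> {Stay, Shift})"

definition configs :: "('t, 'a) automaton \<Rightarrow> ('t \<Rightarrow> nat \<Rightarrow> 'a) set" where
  "configs M = (\<Pi>\<^sub>E t\<in>tapes M. UNIV \<rightarrow> alphabet M t)"

definition config_dist ::
    "('t, 'a) automaton \<Rightarrow> ('t \<Rightarrow> nat \<Rightarrow> 'a) \<Rightarrow> ('t \<Rightarrow> nat \<Rightarrow> 'a) \<Rightarrow> real" where
  "config_dist M u v = (\<Sum>t\<in>tapes M. seq_dist (u t) (v t))"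

definition config_metric :: "('t, 'a) automaton \<Rightarrow> ('t \<Rightarrow> nat \<Rightarrow> 'a) metric" where
  "config_metric M = metric (configs M, config_dist M)"

definition heads :: "('t, 'a) automaton \<Rightarrow> ('t \<Rightarrow> nat \<Rightarrow> 'a) \<Rightarrow> 't \<Rightarrow> 'a" where
  "heads M u = (\<lambda>t\<in>tapes M. u t 0)"

definition step :: "('t, 'a) automaton \<Rightarrow> ('t \<Rightarrow> nat \<Rightarrow> 'a) \<Rightarrow> 't \<Rightarrow> nat \<Rightarrow> 'a" where
  "step M u = (\<lambda>t\<in>tapes M. act (trans M t (heads M u)) (u t))"

definition input_tape :: "('t, 'a) automaton \<Rightarrow> 't \<Rightarrow> bool" where
  "input_tape M t \<longleftrightarrow> (\<forall>q\<in>states M. trans M t q \<in> {Stay, Shift})"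

definition output_tape :: "('t, 'a) automaton \<Rightarrow> 't \<Rightarrow> bool" where
  "output_tape M t \<longleftrightarrow> (\<forall>q\<in>states M. trans M t q \<in> Push ` alphabet M t \<union> {Stay})"

definition finite_automaton :: "('t, 'a) automaton \<Rightarrow> bool" where
  "finite_automaton M \<longleftrightarrow>
     automaton M \<and> (\<forall>t\<in>tapes M. input_tape M t \<or> output_tape M t)"

text \<open>
  The constant \<open>metric\<close> is only meaningful on pairs that satisfy the metric axioms. They hold
  here when there are finitely many tapes.
\<close>

lemma seq_dist_nonneg: "0 \<le> seq_dist u v"
  by (simp add: seq_dist_def)

lemma seq_dist_commute: "seq_dist u v = seq_dist v u"
proof -
  have "(\<lambda>i. u i \<noteq> v i) = (\<lambda>i. v i \<noteq> u i)" by auto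
  then show ?thesis by (auto simp: seq_dist_def)
qed

lemma seq_dist_eq_0_iff: "seq_dist u v = 0 \<longleftrightarrow> u = v"
  by (simp add: seq_dist_def)

lemma seq_dist_ultra: "seq_dist u w \<le> max (seq_dist u v) (seq_dist v w)"
proof (cases "u = w \<or> u = v \<or> v = w")
  case True
  then show ?thesis
    using seq_dist_nonneg[of u v] seq_dist_nonneg[of v w] by (auto simp: seq_dist_def le_max_iff_disj)
next
  case False
  define n where "n = (LEAST i. u i \<noteq> w i)"
  have "\<exists>i. u i \<noteq> w i" using False by auto
  then have "u n \<noteq> w n" unfolding n_def by (rule LeastI_ex)
  then have "u n \<noteq> v n \<or> v n \<noteq> w n" by auto
  then have "(LEAST i. u i \<noteq> v i) \<le> n \<or> (LEAST i. v i \<noteq> w i) \<le> n"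
    by (auto intro: Least_le)
  then have "(1 / 2) ^ n \<le> max ((1 / 2 :: real) ^ (LEAST i. u i \<noteq> v i)) ((1 / 2) ^ (LEAST i. v i \<noteq> w i))"
    by (auto simp: le_max_iff_disj intro: power_decreasing)
  then show ?thesis using False by (simp add: seq_dist_def n_def)
qed

lemma seq_dist_triangle: "seq_dist u w \<le> seq_dist u v + seq_dist v w"
  using seq_dist_ultra[of u w v] seq_dist_nonneg[of u v] seq_dist_nonneg[of v w] by linarith

lemma Metric_space_configs:
  assumes "finite (tapes M)"
  shows "Metric_space (configs M) (config_dist M)"
proof
  fix u v :: "'a \<Rightarrow> nat \<Rightarrow> 'b"
  show "0 \<le> config_dist M u v"
    by (simp add: config_dist_def sum_nonneg seq_dist_nonneg)
  show "config_dist M u v = config_dist M v u"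
    by (simp add: config_dist_def seq_dist_commute)
next
  fix u v assume uv: "u \<in> configs M" "v \<in> configs M"
  have "config_dist M u v = 0 \<longleftrightarrow> (\<forall>t\<in>tapes M. u t = v t)"
    using assms
    by (simp add: config_dist_def sum_nonneg_eq_0_iff seq_dist_nonneg seq_dist_eq_0_iff)
  also have "\<dots> \<longleftrightarrow> u = v"
    using uv by (auto simp: configs_def intro: PiE_ext)
  finally show "config_dist M u v = 0 \<longleftrightarrow> u = v" .
next
  fix u v w :: "'a \<Rightarrow> nat \<Rightarrow> 'b"
  show "config_dist M u w \<le> config_dist M u v + config_dist M v w"
    by (simp add: config_dist_def seq_dist_triangle sum_mono flip: sum.distrib)
qed

lemma
  assumes "finite (tapes M)"
  shows mspace_config_metric: "mspace (config_metric M) = configs M"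
    and mdist_config_metric: "mdist (config_metric M) = config_dist M"
  using Metric_space_configs[OF assms]
  by (simp_all add: config_metric_def Metric_space.mspace_metric Metric_space.mdist_metric)

end

theory Submission
  imports Defs
begin

text \<open>
  The map \<open>G = g \<circ> g\<close> is strictly increasing. An extra tape that alternates between 0 and 1 turns
  a factor map onto \<open>G\<close> into one onto \<open>g\<close>, so only increasing maps matter. Let \<open>p\<close> and \<open>q\<close> be
  the limits of the orbits of the end points \<open>a\<close> and \<open>b\<close>. On \<open>{p..q}\<close> the map \<open>G\<close> is a homeomorphism
  onto, and there is a compact set \<open>D\<close> which meets all orbits and on which \<open>G\<^sup>k\<close> is uniformly Cauchy for
  \<open>k \<rightarrow> \<infinity>\<close> and for \<open>k \<rightarrow> -\<infinity>\<close>. Hence \<open>(y, k) \<mapsto> G\<^sup>k y\<close> extends continuously to the product of \<open>D\<close>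
  with the two-point compactification of the integers. A constant binary tape codes \<open>y\<close>, and
  \<open>k\<close> is counted down on an input tape while it is negative and counted up on an output tape afterwards.
  Outside \<open>{p..q}\<close> there are no complete backward orbits, but the forward orbits of
  \<open>{a..G a} \<union> {G b..b}\<close> suffice there.
\<close>

section \<open>The space of configurations\<close>

lemma seq_dist_less_imp_eq:
  assumes "seq_dist u v < (1 / 2) ^ n" and "i \<le> n"
  shows "u i = v i"
proof (rule ccontr)
  assume ne: "u i \<noteq> v i"
  then have "(LEAST j. u j \<noteq> v j) \<le> n"
    using assms(2) by (meson Least_le le_trans)
  then have "(1 / 2 :: real) ^ n \<le> (1 / 2) ^ (LEAST j. u j \<noteq> v j)"
    by (intro power_decreasing) auto
  with ne assms(1) show False
    by (auto simp: seq_dist_def split: if_splits)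
qed

lemma seq_dist_le_power:
  assumes "\<And>i. i < n \<Longrightarrow> u i = v i"
  shows "seq_dist u v \<le> (1 / 2) ^ n"
proof (cases "u = v")
  case False
  then have "\<exists>i. u i \<noteq> v i" by auto
  then have "u (LEAST i. u i \<noteq> v i) \<noteq> v (LEAST i. u i \<noteq> v i)" by (rule LeastI_ex)
  then have "n \<le> (LEAST i. u i \<noteq> v i)"
    using assms leI by blast
  with False show ?thesis
    by (simp add: seq_dist_def power_decreasing)
qed (simp add: seq_dist_def)

text \<open>Finite-prefix form of closeness in the product metric. The next two lemmas show that
  prefixes and balls determine the same neighbourhoods, so continuity can be checked on
  prefixes.\<close>

definition agree :: "('t, 'a) automaton \<Rightarrow> nat \<Rightarrow> ('t \<Rightarrow> nat \<Rightarrow> 'a) \<Rightarrow> ('t \<Rightarrow> nat \<Rightarrow> 'a) \<Rightarrow> bool" where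
  "agree M n u v \<longleftrightarrow> (\<forall>t\<in>tapes M. \<forall>i<n. u t i = v t i)"

lemma config_dist_less_imp_agree:
  assumes fin: "finite (tapes M)" and less: "config_dist M u v < (1 / 2) ^ n"
  shows "agree M n u v"
  unfolding agree_def
proof (intro ballI allI impI)
  fix t i assume t: "t \<in> tapes M" and "i < n"
  have "seq_dist (u t) (v t) \<le> config_dist M u v"
    unfolding config_dist_def using fin t
    by (intro member_le_sum) (auto simp: seq_dist_nonneg)
  with less have "seq_dist (u t) (v t) < (1 / 2) ^ n" by linarith
  then show "u t i = v t i"
    using \<open>i < n\<close> by (intro seq_dist_less_imp_eq) auto
qed

lemma agree_imp_config_dist_less:
  assumes "0 < e"
  obtains n where "\<And>u v. agree M n u v \<Longrightarrow> config_dist M u v < e"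
proof -
  \<comment> \<open>The summand 1 keeps the denominator positive when there are no tapes.\<close>
  obtain n where n: "(1 / 2 :: real) ^ n < e / (card (tapes M) + 1)"
    using real_arch_pow_inv[of "e / (card (tapes M) + 1)" "1 / 2"] assms by auto
  have "config_dist M u v < e" if "agree M n u v" for u v
  proof -
    have "config_dist M u v \<le> (\<Sum>t\<in>tapes M. (1 / 2) ^ n)"
      unfolding config_dist_def using that
      by (intro sum_mono seq_dist_le_power) (auto simp: agree_def)
    also have "\<dots> \<le> (card (tapes M) + 1) * (1 / 2) ^ n"
      by (simp add: algebra_simps)
    also have "\<dots> < e"
      using n by (simp add: field_simps)
    finally show ?thesis .
  qed
  then show thesis using that by blast
qed

lemma continuous_map_from_configs:
  assumes fin: "finite (tapes M)"
    and maps: "\<And>u. u \<in> configs M \<Longrightarrow> \<phi> u \<in> mspace Y"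
    and cont: "\<And>u e. u \<in> configs M \<Longrightarrow> 0 < e \<Longrightarrow> \<exists>n. \<forall>v\<in>configs M. agree M n u v \<longrightarrow> mdist Y (\<phi> u) (\<phi> v) < e"
  shows "continuous_map (mtopology_of (config_metric M)) (mtopology_of Y) \<phi>"
  unfolding mtopology_of_def mspace_config_metric[OF fin] mdist_config_metric[OF fin]
    Metric_space.metric_continuous_map[OF Metric_space_configs[OF fin] Metric_space_mspace_mdist]
proof (intro conjI ballI allI impI)
  show "\<phi> ` configs M \<subseteq> mspace Y"
    using maps by blast
next
  fix u and e :: real assume "u \<in> configs M" "0 < e"
  with cont obtain n where
    "\<forall>v\<in>configs M. agree M n u v \<longrightarrow> mdist Y (\<phi> u) (\<phi> v) < e" by blast
  then show "\<exists>\<delta>>0. \<forall>v. v \<in> configs M \<and> config_dist M u v < \<delta> \<longrightarrow> mdist Y (\<phi> u) (\<phi> v) < e"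
    using config_dist_less_imp_agree[OF fin, of u _ n]
    by (intro exI[of _ "(1 / 2) ^ n"]) auto
qed

text \<open>By Tychonoff the product of the finite discrete alphabets is compact. Prefix conditions
  are open in it, so the identity onto the metric space is continuous and carries compactness
  over.\<close>

lemma compact_space_config_metric:
  assumes fin: "finite (tapes M)" and fin_alphabet: "\<And>t. t \<in> tapes M \<Longrightarrow> finite (alphabet M t)"
  shows "compact_space (mtopology_of (config_metric M))"
proof -
  define P where "P = product_topology
    (\<lambda>t. product_topology (\<lambda>_::nat. discrete_topology (alphabet M t)) UNIV) (tapes M)"
  have top: "topspace P = configs M"
    by (auto simp: P_def configs_def PiE_def Pi_def)
  have "compact_space P"
    unfolding P_def using fin_alphabet
    by (auto simp: compact_space_product_topology compact_space_discrete_topology)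
  moreover have "continuous_map P (mtopology_of (config_metric M)) id"
    unfolding mtopology_of_def Metric_space.continuous_map_to_metric[OF Metric_space_mspace_mdist]
  proof (intro ballI allI impI)
    fix u and e :: real assume u: "u \<in> topspace P" and "0 < e"
    obtain n where n: "\<And>u v. agree M n u v \<Longrightarrow> config_dist M u v < e"
      using agree_imp_config_dist_less[OF \<open>0 < e\<close>] by blast
    define W where "W t i = {v \<in> topspace P. v t i \<in> {u t i}}" for t i
    have "openin P (W t i)" if "t \<in> tapes M" for t i
    proof -
      have "continuous_map P (product_topology (\<lambda>_::nat. discrete_topology (alphabet M t)) UNIV) (\<lambda>v. v t)"
        unfolding P_def by (rule continuous_map_product_projection[OF that])
      from continuous_map_compose[OF this continuous_map_product_projection[of i]]
      have "continuous_map P (discrete_topology (alphabet M t)) (\<lambda>v. v t i)"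
        by (simp add: o_def)
      moreover have "u t i \<in> alphabet M t"
        using u that by (auto simp: top configs_def)
      ultimately show ?thesis
        unfolding W_def by (intro openin_continuous_map_preimage) auto
    qed
    then have "openin P (\<Inter>z\<in>tapes M \<times> {..<n}. W (fst z) (snd z) )"
      if "tapes M \<times> {..<n} \<noteq> {}"
      using that fin by (intro openin_Inter) auto
    \<comment> \<open>Without tapes or with \<open>n = 0\<close> the intersection would be
      \<open>UNIV\<close> instead of the whole space.\<close>
    moreover define U where
      "U = (if tapes M \<times> {..<n} = {} then topspace P else \<Inter>z\<in>tapes M \<times> {..<n}. W (fst z) (snd z))"
    ultimately have "openin P U" by auto
    moreover have "u \<in> U" using u by (auto simp: U_def W_def)
    moreover have "agree M n u v \<and> v \<in> configs M" if "v \<in> U" for v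
      using that by (auto simp: U_def W_def agree_def top split: if_splits)
    ultimately show "\<exists>U. openin P U \<and> u \<in> U \<and> (\<forall>y\<in>U. id y \<in> Metric_space.mball
         (mspace (config_metric M)) (mdist (config_metric M)) (id u) e)"
      using u n by (intro exI[of _ U])
        (auto simp: Metric_space.in_mball[OF Metric_space_configs[OF fin]] mspace_config_metric[OF fin]
           mdist_config_metric[OF fin] top)
  qed
  ultimately have "compactin (mtopology_of (config_metric M)) (id ` topspace P)"
    unfolding compact_space_def by (rule image_compactin)
  then show ?thesis
    by (simp add: compact_space_def top mspace_config_metric[OF fin])
qed

section \<open>Continuity of the step map\<close>

lemma step_in_configs:
  assumes M: "automaton M" and u: "u \<in> configs M"
  shows "step M u \<in> configs M"
proof -
  have q: "heads M u \<in> states M"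
    using u by (auto simp: heads_def states_def configs_def)
  have "act (trans M t (heads M u)) (u t) i \<in> alphabet M t" if t: "t \<in> tapes M" for t i
  proof -
    have ut: "\<And>i. u t i \<in> alphabet M t"
      using u t by (auto simp: configs_def)
    have "trans M t (heads M u) \<in> Push ` alphabet M t \<union> {Stay, Shift}"
      using M t q by (auto simp: automaton_def)
    then show ?thesis
      using ut by (auto split: nat.split)
  qed
  then show ?thesis
    by (auto simp: step_def configs_def)
qed

lemma act_cong:
  assumes "\<And>i. i < Suc n \<Longrightarrow> u i = v i" and "i < n"
  shows "act a u i = act a v i"
  using assms by (cases a) (auto split: nat.split)

text \<open>A step reads only the first cells and moves a tape by at most one cell, so one cell of
  precision is lost.\<close>

lemma agree_step:
  assumes "agree M (Suc n) u v"
  shows "agree M n (step M u) (step M v)"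
proof -
  have "heads M u = heads M v"
    using assms by (auto simp: heads_def agree_def)
  moreover have "act a (u t) i = act a (v t) i" if "t \<in> tapes M" "i < n" for a t i
    using assms that by (intro act_cong[of n]) (auto simp: agree_def)
  ultimately show ?thesis
    by (simp add: agree_def step_def)
qed

lemma dynamical_system_automaton:
  assumes M: "automaton M"
  shows "dynamical_system (config_metric M) (step M)"
proof -
  have fin: "finite (tapes M)" and fina: "\<And>t. t \<in> tapes M \<Longrightarrow> finite (alphabet M t)"
    using M by (auto simp: automaton_def)
  have "continuous_map (mtopology_of (config_metric M)) (mtopology_of (config_metric M)) (step M)"
  proof (rule continuous_map_from_configs[OF fin])
    show "step M u \<in> mspace (config_metric M)" if "u \<in> configs M" for u
      using step_in_configs[OF M that] by (simp add: mspace_config_metric[OF fin])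
    fix u and e :: real assume "0 < e"
    then obtain n where "\<And>u v. agree M n u v \<Longrightarrow> config_dist M u v < e"
      using agree_imp_config_dist_less by blast
    then show "\<exists>n. \<forall>v\<in>configs M. agree M n u v \<longrightarrow>
        mdist (config_metric M) (step M u) (step M v) < e"
      by (intro exI[of _ "Suc n"]) (simp add: mdist_config_metric[OF fin] agree_step)
  qed
  with compact_space_config_metric[OF fin fina] show ?thesis
    by (simp add: dynamical_system_def)
qed

section \<open>A coding of compact sets of reals by binary sequences\<close>

text \<open>Bisection: the bit \<open>s n\<close> selects a half of the current interval, but is overruled when
  that half misses \<open>S\<close>. Hence every \<open>s\<close> converges to a point of \<open>S\<close>.\<close>

fun bisect :: "real set \<Rightarrow> real \<Rightarrow> real \<Rightarrow> (nat \<Rightarrow> nat) \<Rightarrow> nat \<Rightarrow> real" where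
  "bisect S l w s 0 = l"
| "bisect S l w s (Suc n) =
    (let x = bisect S l w s n; m = x + w / 2 ^ Suc n in
     if (s n = 0 \<and> S \<inter> {x..m} \<noteq> {}) \<or> S \<inter> {m..m + w / 2 ^ Suc n} = {} then x else m)"

lemma bisect_Suc:
  assumes "x = bisect S l w s n" and "h = w / 2 ^ Suc n"
  shows "bisect S l w s (Suc n) =
    (if (s n = 0 \<and> S \<inter> {x..x + h} \<noteq> {}) \<or> S \<inter> {x + h..x + h + h} = {} then x else x + h)"
  unfolding assms by (simp only: bisect.simps Let_def)

text \<open>The two halves cover the current interval, and a half that misses \<open>S\<close> is
  never taken while the other one meets \<open>S\<close>.\<close>

lemma bisect_meets:
  assumes "S \<inter> {l..l + w} \<noteq> {}"
  shows "S \<inter> {bisect S l w s n..bisect S l w s n + w / 2 ^ n} \<noteq> {}"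
proof (induction n)
  case (Suc n)
  define x where "x = bisect S l w s n"
  define h where "h = w / 2 ^ Suc n"
  have h: "w / 2 ^ n = h + h" by (simp add: h_def)
  have "{x..x + (h + h)} \<subseteq> {x..x + h} \<union> {x + h..x + h + h}" by auto
  with Suc have "S \<inter> {x..x + h} \<noteq> {} \<or> S \<inter> {x + h..x + h + h} \<noteq> {}"
    unfolding x_def[symmetric] h by blast
  then show ?case
    unfolding bisect_Suc[OF x_def h_def] h_def[symmetric] by presburger
qed (use assms in simp)

lemma bisect_cong: "(\<And>i. i < n \<Longrightarrow> s i = s' i) \<Longrightarrow> bisect S l w s n = bisect S l w s' n"
  by (induction n) (simp_all add: Let_def)

lemma bisect_step:
  assumes "0 \<le> w"
  shows "bisect S l w s n \<le> bisect S l w s (Suc n)"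
    and "bisect S l w s (Suc n) + w / 2 ^ Suc n \<le> bisect S l w s n + w / 2 ^ n"
proof -
  define x where "x = bisect S l w s n"
  define h where "h = w / 2 ^ Suc n"
  have h: "w / 2 ^ n = h + h" by (simp add: h_def)
  have "0 \<le> h" using assms by (simp add: h_def)
  then show "bisect S l w s n \<le> bisect S l w s (Suc n)"
    and "bisect S l w s (Suc n) + w / 2 ^ Suc n \<le> bisect S l w s n + w / 2 ^ n"
    unfolding bisect_Suc[OF x_def h_def] h h_def[symmetric] x_def[symmetric] by simp_all
qed

text \<open>Compact sets of reals are continuous images of Cantor space: \<open>n\<close> bits
  determine the limit up to \<open>w / 2 ^ n\<close>. Every nonzero bit acts like 1, so
  \<open>\<psi>\<close> has values in \<open>S\<close> on all sequences.\<close>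

lemma binary_coding:
  fixes S :: "real set"
  assumes "compact S" and "S \<noteq> {}"
  obtains \<psi> :: "(nat \<Rightarrow> nat) \<Rightarrow> real" where
    "\<And>s. \<psi> s \<in> S"
    "\<And>y. y \<in> S \<Longrightarrow> \<exists>s. range s \<subseteq> {0, 1} \<and> \<psi> s = y"
    "\<And>e. 0 < e \<Longrightarrow> \<exists>n. \<forall>s s'. (\<forall>i<n. s i = s' i) \<longrightarrow> \<bar>\<psi> s - \<psi> s'\<bar> < e"
proof -
  obtain c where c: "\<And>x. x \<in> S \<Longrightarrow> \<bar>x\<bar> \<le> c"
    using compact_imp_bounded[OF assms(1)] by (auto simp: bounded_iff)
  have c0: "0 \<le> c" using c assms(2) by fastforce
  define w where "w = 2 * c"
  define x where "x = bisect S (- c) w"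
  have w0: "0 \<le> w" using c0 by (simp add: w_def)
  have "S \<subseteq> {- c..- c + w}" using c by (fastforce simp: w_def abs_le_iff)
  then have meets: "S \<inter> {x s n..x s n + w / 2 ^ n} \<noteq> {}" for s n
    unfolding x_def using assms(2) by (intro bisect_meets) blast
  have inc: "incseq (x s)" for s
    unfolding x_def by (rule incseq_SucI) (rule bisect_step[OF w0])
  have dec: "decseq (\<lambda>n. x s n + w / 2 ^ n)" for s
    unfolding x_def by (rule decseq_SucI) (rule bisect_step[OF w0])
  have bnd: "x s n \<le> x s 0 + w / 2 ^ 0" for s n
  proof -
    have "x s n \<le> x s n + w / 2 ^ n" using w0 by simp
    also have "\<dots> \<le> x s 0 + w / 2 ^ 0" by (rule decseqD[OF dec]) simp
    finally show ?thesis .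
  qed
  have lim0: "(\<lambda>n. w / 2 ^ n) \<longlonglongrightarrow> 0"
    by (rule LIMSEQ_divide_realpow_zero) simp
  define \<psi> where "\<psi> s = lim (x s)" for s
  have conv: "x s \<longlonglongrightarrow> \<psi> s" for s
  proof -
    obtain L where "x s \<longlonglongrightarrow> L"
      using incseq_convergent[OF inc, of s] bnd by blast
    then show ?thesis by (simp add: \<psi>_def limI)
  qed
  have lower: "x s n \<le> \<psi> s" for s n
    by (rule incseq_le[OF inc conv])
  have conv': "(\<lambda>n. x s n + w / 2 ^ n) \<longlonglongrightarrow> \<psi> s" for s
    using tendsto_add[OF conv lim0] by simp
  have upper: "\<psi> s \<le> x s n + w / 2 ^ n" for s n
    by (rule decseq_ge[OF dec conv'])
  show thesis
  proof
    fix s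
    \<comment> \<open>Each bisection interval contains a point of \<open>S\<close>. These points
      converge to \<open>\<psi> s\<close>, and \<open>S\<close> is closed.\<close>
    have "\<forall>n. \<exists>y. y \<in> S \<and> x s n \<le> y \<and> y \<le> x s n + w / 2 ^ n"
      using meets[of s] by fastforce
    then obtain y where y: "\<And>n. y n \<in> S" "\<And>n. x s n \<le> y n" "\<And>n. y n \<le> x s n + w / 2 ^ n"
      by metis
    have "y \<longlonglongrightarrow> \<psi> s"
      using y by (intro tendsto_sandwich[OF _ _ conv conv']) auto
    with y(1) show "\<psi> s \<in> S"
      using compact_imp_closed[OF assms(1)] closed_sequentially by blast
  next
    fix y assume y: "y \<in> S"
    \<comment> \<open>Plain bisection aimed at \<open>y\<close>; it is independent of
      \<open>s\<close> because \<open>s\<close> is read off from its choices. The chosen half always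
      contains \<open>y \<in> S\<close>, hence no bit of \<open>s\<close> is overruled.\<close>
    define bs where "bs = rec_nat (- c) (\<lambda>n z. if y \<le> z + w / 2 ^ Suc n then z else z + w / 2 ^ Suc n)"
    define s where "s n = (if y \<le> bs n + w / 2 ^ Suc n then 0 else 1 :: nat)" for n
    have *: "x s n = bs n \<and> x s n \<le> y \<and> y \<le> x s n + w / 2 ^ n" for n
    proof (induction n)
      case 0
      show ?case using c[OF y] by (auto simp: x_def bs_def w_def)
    next
      case (Suc n)
      define h where "h = w / 2 ^ Suc n"
      have h: "w / 2 ^ n = h + h" by (simp add: h_def)
      have b: "bs (Suc n) = (if y \<le> bs n + h then bs n else bs n + h)"
        by (simp add: bs_def h_def)
      have "x s (Suc n) = (if (s n = 0 \<and> S \<inter> {bs n..bs n + h} \<noteq> {}) \<or>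
          S \<inter> {bs n + h..bs n + h + h} = {} then bs n else bs n + h)"
        using Suc by (simp only: x_def bisect.simps Let_def h_def)
      moreover have "s n = (if y \<le> bs n + h then 0 else 1)"
        by (simp add: s_def h_def)
      moreover have "bs n \<le> y" "y \<le> bs n + h + h"
        using Suc by (simp_all add: h)
      ultimately have "x s (Suc n) = (if y \<le> bs n + h then bs n else bs n + h)"
        using y by auto
      with b \<open>bs n \<le> y\<close> \<open>y \<le> bs n + h + h\<close> show ?case
        unfolding h_def[symmetric] by simp
    qed
    have "x s n \<le> y" "y \<le> x s n + w / 2 ^ n" for n
      using *[of n] by simp_all
    then have "\<psi> s \<le> y" "y \<le> \<psi> s"
      using LIMSEQ_le_const2[OF conv] LIMSEQ_le_const[OF conv'] by blast+
    then show "\<exists>s. range s \<subseteq> {0, 1} \<and> \<psi> s = y"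
      by (intro exI[of _ s]) (auto simp: s_def)
  next
    fix e :: real assume "0 < e"
    then obtain n where n: "w / 2 ^ n < e"
      using order_tendstoD(2)[OF lim0] by (auto simp: eventually_sequentially)
    have "\<bar>\<psi> s - \<psi> s'\<bar> < e" if "\<forall>i<n. s i = s' i" for s s'
    proof -
      have "x s n = x s' n" unfolding x_def using that by (intro bisect_cong) auto
      then show ?thesis using n lower[of s n] lower[of s' n] upper[of s n] upper[of s' n] by linarith
    qed
    then show "\<exists>n. \<forall>s s'. (\<forall>i<n. s i = s' i) \<longrightarrow> \<bar>\<psi> s - \<psi> s'\<bar> < e" by blast
  qed
qed

section \<open>Monotone interval maps\<close>

text \<open>Take the first \<open>j\<close> at distance at least \<open>h\<close> from the start.
  The previous point was closer than \<open>h\<close>, so \<open>x j\<close> is closer than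
  \<open>2 * h\<close>, which leaves more than \<open>h\<close> to the end.\<close>

lemma discrete_intermediate:
  fixes x :: "nat \<Rightarrow> real"
  assumes steps: "\<And>i. i < k \<Longrightarrow> \<bar>x (Suc i) - x i\<bar> < h" and far: "3 * h < \<bar>x k - x 0\<bar>" and "0 < h"
  obtains j where "j \<le> k" "h \<le> \<bar>x j - x 0\<bar>" "h \<le> \<bar>x k - x j\<bar>"
proof -
  define j where "j = (LEAST j. h \<le> \<bar>x j - x 0\<bar>)"
  have "h \<le> \<bar>x k - x 0\<bar>" using far \<open>0 < h\<close> by linarith
  then have j: "h \<le> \<bar>x j - x 0\<bar>" "j \<le> k"
    unfolding j_def by (auto intro: LeastI Least_le)
  with \<open>0 < h\<close> obtain i where i: "j = Suc i" by (cases j) auto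
  then have "\<bar>x i - x 0\<bar> < h"
    using not_less_Least[of i "\<lambda>j. h \<le> \<bar>x j - x 0\<bar>"] by (simp add: j_def)
  moreover have "\<bar>x j - x i\<bar> < h" using steps i j(2) by simp
  ultimately have "h \<le> \<bar>x k - x j\<bar>" using far by linarith
  with j show thesis using that by blast
qed

locale mono_interval_map =
  fixes a b :: real and G :: "real \<Rightarrow> real"
  assumes cont: "continuous_on {a..b} G"
    and into: "x \<in> {a..b} \<Longrightarrow> G x \<in> {a..b}"
    and mono: "x \<in> {a..b} \<Longrightarrow> y \<in> {a..b} \<Longrightarrow> x \<le> y \<Longrightarrow> G x \<le> G y"
begin

lemma funpow_into: "x \<in> {a..b} \<Longrightarrow> (G ^^ k) x \<in> {a..b}"
  using into by (induction k) auto

lemma funpow_mono_on: "x \<in> {a..b} \<Longrightarrow> y \<in> {a..b} \<Longrightarrow> x \<le> y \<Longrightarrow> (G ^^ k) x \<le> (G ^^ k) y"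
proof (induction k)
  case (Suc k)
  then show ?case using mono[OF funpow_into funpow_into] by simp
qed simp

lemma funpow_cont: "continuous_on {a..b} (G ^^ k)"
proof (induction k)
  case (Suc k)
  have "continuous_on ((G ^^ k) ` {a..b}) G"
    by (rule continuous_on_subset[OF cont]) (use funpow_into in blast)
  from continuous_on_compose[OF Suc this] show ?case by (simp add: o_def)
qed (simp add: id_def)

lemma funpow_fixed: "G f = f \<Longrightarrow> (G ^^ k) f = f"
  by (induction k) auto

lemma funpow_incseq:
  assumes "x \<in> {a..b}" "x \<le> G x"
  shows "incseq (\<lambda>k. (G ^^ k) x)"
proof (rule incseq_SucI)
  fix k show "(G ^^ k) x \<le> (G ^^ Suc k) x"
    using funpow_mono_on[OF assms(1) into[OF assms(1)] assms(2)] by (simp add: funpow_swap1)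
qed

lemma funpow_decseq:
  assumes "x \<in> {a..b}" "G x \<le> x"
  shows "decseq (\<lambda>k. (G ^^ k) x)"
proof (rule decseq_SucI)
  fix k show "(G ^^ Suc k) x \<le> (G ^^ k) x"
    using funpow_mono_on[OF into[OF assms(1)] assms(1) assms(2)] by (simp add: funpow_swap1)
qed

lemma funpow_between:
  assumes "x \<in> {a..b}" "j \<le> k"
  shows "min x ((G ^^ k) x) \<le> (G ^^ j) x \<and> (G ^^ j) x \<le> max x ((G ^^ k) x)"
proof (cases "x \<le> G x")
  case True
  with funpow_incseq[OF assms(1) True] assms(2) show ?thesis
    using incseqD[of "\<lambda>k. (G ^^ k) x" 0 j] incseqD[of "\<lambda>k. (G ^^ k) x" j k] by auto
next
  case False
  then have "decseq (\<lambda>k. (G ^^ k) x)" using funpow_decseq[OF assms(1)] by simp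
  with assms(2) show ?thesis
    using decseqD[of "\<lambda>k. (G ^^ k) x" 0 j] decseqD[of "\<lambda>k. (G ^^ k) x" j k] by auto
qed

lemma funpow_converges:
  assumes x: "x \<in> {a..b}"
  obtains l where "l \<in> {a..b}" "G l = l" "(\<lambda>k. (G ^^ k) x) \<longlonglongrightarrow> l"
proof -
  have "monoseq (\<lambda>k. (G ^^ k) x)"
    using funpow_incseq[OF x] funpow_decseq[OF x] linear[of x "G x"] by (auto simp: monoseq_iff)
  moreover have "Bseq (\<lambda>k. (G ^^ k) x)"
  proof (rule BseqI')
    show "norm ((G ^^ k) x) \<le> \<bar>a\<bar> + \<bar>b\<bar>" for k
      using funpow_into[OF x, of k] by auto
  qed
  ultimately obtain l where l: "(\<lambda>k. (G ^^ k) x) \<longlonglongrightarrow> l"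
    using Bseq_monoseq_convergent by (auto simp: convergent_def)
  have lab: "l \<in> {a..b}"
    using closed_sequentially[OF closed_atLeastAtMost _ l] funpow_into[OF x] by blast
  have "(\<lambda>k. G ((G ^^ k) x)) \<longlonglongrightarrow> G l"
    by (rule continuous_on_tendsto_compose[OF cont l lab]) (use funpow_into[OF x] in simp)
  moreover have "(\<lambda>k. G ((G ^^ k) x)) \<longlonglongrightarrow> l"
    using LIMSEQ_Suc[OF l] by simp
  ultimately have "G l = l" by (rule LIMSEQ_unique)
  with lab l that show thesis by blast
qed

text \<open>By monotonicity the orbit of \<open>y\<close> stays between the orbits of
  \<open>l\<close> and \<open>u\<close>, and these have a common limit.\<close>

lemma funpow_squeeze:
  assumes lu: "l \<in> {a..b}" "u \<in> {a..b}" and "0 < e"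
    and lims: "(\<lambda>k. (G ^^ k) l) \<longlonglongrightarrow> z" "(\<lambda>k. (G ^^ k) u) \<longlonglongrightarrow> z"
  shows "\<exists>N. \<forall>y\<in>{l..u}. \<forall>i\<ge>N. \<forall>j\<ge>N. \<bar>(G ^^ i) y - (G ^^ j) y\<bar> \<le> e"
proof -
  have "\<forall>\<^sub>F k in sequentially. z - e / 2 < (G ^^ k) l \<and> (G ^^ k) u < z + e / 2"
    using order_tendstoD(1)[OF lims(1), of "z - e / 2"] order_tendstoD(2)[OF lims(2), of "z + e / 2"] \<open>0 < e\<close>
    by (auto intro: eventually_conj)
  then obtain N where N: "\<And>k. k \<ge> N \<Longrightarrow> z - e / 2 < (G ^^ k) l \<and> (G ^^ k) u < z + e / 2"
    by (auto simp: eventually_sequentially)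
  have "z - e / 2 \<le> (G ^^ k) y \<and> (G ^^ k) y \<le> z + e / 2" if "y \<in> {l..u}" "k \<ge> N" for y k
    using N[OF that(2)] funpow_mono_on[of l y k] funpow_mono_on[of y u k] lu that by fastforce
  then have "\<bar>(G ^^ i) y - (G ^^ j) y\<bar> \<le> e" if "y \<in> {l..u}" "i \<ge> N" "j \<ge> N" for y i j
    using that by (smt (verit) field_sum_of_halves)
  then show ?thesis by blast
qed

text \<open>The intervals between successive iterates of \<open>a\<close> exhaust the points below
  \<open>p\<close>, and by the intermediate value theorem each is covered by an iterate of
  \<open>{a..G a}\<close>. The other end is symmetric.\<close>

lemma forward_sweep:
  assumes x: "x \<in> {a..b}"
    and lims: "(\<lambda>k. (G ^^ k) a) \<longlonglongrightarrow> p" "(\<lambda>k. (G ^^ k) b) \<longlonglongrightarrow> q"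
  shows "x \<in> {p..q} \<or> (\<exists>y\<in>{a..G a} \<union> {G b..b}. \<exists>k. x = (G ^^ k) y)"
proof -
  have ab: "a \<in> {a..b}" "b \<in> {a..b}" using x by auto
  have Gab: "G a \<in> {a..b}" "G b \<in> {a..b}" using into ab by auto
  consider "x < p" | "q < x" | "x \<in> {p..q}" by fastforce
  then show ?thesis
  proof cases
    case 1
    then obtain n where n: "x < (G ^^ n) a"
      using order_tendstoD(1)[OF lims(1)] by (auto simp: eventually_sequentially)
    define k where "k = (LEAST n. x < (G ^^ n) a)"
    have k: "x < (G ^^ k) a" unfolding k_def using n by (rule LeastI)
    with x obtain j where j: "k = Suc j" by (cases k) auto
    then have "(G ^^ j) a \<le> x"
      using not_less_Least[of j "\<lambda>n. x < (G ^^ n) a"] by (simp add: k_def)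
    moreover have "x \<le> (G ^^ j) (G a)" using k by (simp add: j funpow_swap1)
    ultimately have "\<exists>y. a \<le> y \<and> y \<le> G a \<and> (G ^^ j) y = x"
      using Gab by (intro IVT' continuous_on_subset[OF funpow_cont]) auto
    then show ?thesis by fastforce
  next
    case 2
    then obtain n where n: "(G ^^ n) b < x"
      using order_tendstoD(2)[OF lims(2)] by (auto simp: eventually_sequentially)
    define k where "k = (LEAST n. (G ^^ n) b < x)"
    have k: "(G ^^ k) b < x" unfolding k_def using n by (rule LeastI)
    with x obtain j where j: "k = Suc j" by (cases k) auto
    then have "x \<le> (G ^^ j) b"
      using not_less_Least[of j "\<lambda>n. (G ^^ n) b < x"] by (simp add: k_def)
    moreover have "(G ^^ j) (G b) \<le> x" using k by (simp add: j funpow_swap1)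
    ultimately have "\<exists>y. G b \<le> y \<and> y \<le> b \<and> (G ^^ j) y = x"
      using Gab by (intro IVT' continuous_on_subset[OF funpow_cont]) auto
    then show ?thesis by fastforce
  qed simp
qed

text \<open>The ends of \<open>{a..G a}\<close> lie on one orbit and so have the same limit, which
  allows squeezing; likewise for \<open>{G b..b}\<close>.\<close>

lemma forward_sweep_uniform:
  assumes ab: "a \<le> b" and "0 < e"
  shows "\<exists>N. \<forall>y\<in>{a..G a} \<union> {G b..b}. \<forall>i\<ge>N. \<forall>j\<ge>N. \<bar>(G ^^ i) y - (G ^^ j) y\<bar> \<le> e"
proof -
  have *: "\<exists>N. \<forall>y\<in>{l..u}. \<forall>i\<ge>N. \<forall>j\<ge>N. \<bar>(G ^^ i) y - (G ^^ j) y\<bar> \<le> e"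
    if lu: "l \<in> {a..b}" "u \<in> {a..b}" and G: "u = G l \<or> l = G u" for l u
  proof -
    obtain z where z: "(\<lambda>k. (G ^^ k) l) \<longlonglongrightarrow> z" using funpow_converges[OF lu(1)] by blast
    have "(\<lambda>k. (G ^^ k) u) \<longlonglongrightarrow> z"
    proof (cases "u = G l")
      case True
      with LIMSEQ_Suc[OF z] show ?thesis by (simp add: funpow_swap1)
    next
      case False
      with G have "l = G u" by simp
      with z have "(\<lambda>k. (G ^^ Suc k) u) \<longlonglongrightarrow> z" by (simp add: funpow_swap1)
      then show ?thesis by (rule LIMSEQ_imp_Suc)
    qed
    then show ?thesis using funpow_squeeze[OF lu \<open>0 < e\<close> z] by simp
  qed
  have "a \<in> {a..b}" "b \<in> {a..b}" using ab by auto
  with *[of a "G a"] *[of "G b" b] into obtain N1 N2 where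
    "\<forall>y\<in>{a..G a}. \<forall>i\<ge>N1. \<forall>j\<ge>N1. \<bar>(G ^^ i) y - (G ^^ j) y\<bar> \<le> e"
    "\<forall>y\<in>{G b..b}. \<forall>i\<ge>N2. \<forall>j\<ge>N2. \<bar>(G ^^ i) y - (G ^^ j) y\<bar> \<le> e" by blast
  then show ?thesis by (intro exI[of _ "max N1 N2"]) auto
qed

end

section \<open>Increasing homeomorphisms\<close>

text \<open>The inverse is a parameter, which makes the assumptions symmetric: through
  \<open>swap\<close>, facts about forward orbits become facts about backward orbits.\<close>

locale interval_homeo =
  G: mono_interval_map p q G + H: mono_interval_map p q H for p q G H +
  assumes HG: "x \<in> {p..q} \<Longrightarrow> H (G x) = x"
    and GH: "x \<in> {p..q} \<Longrightarrow> G (H x) = x"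
begin

lemma swap: "interval_homeo p q H G"
  using HG GH by (unfold_locales) auto

text \<open>The length of the two orbit steps around \<open>x\<close>. It vanishes exactly at the
  fixed points and, unlike \<open>\<bar>G x - x\<bar>\<close>, is the same function for
  \<open>G\<close> and \<open>H\<close>.\<close>

definition gap :: "real \<Rightarrow> real" where
  "gap x = \<bar>G x - H x\<bar>"

lemma gap_swap: "interval_homeo.gap H G = gap"
  by (auto simp: interval_homeo.gap_def[OF swap] gap_def fun_eq_iff abs_minus_commute)

lemma gap_nonneg: "0 \<le> gap x"
  by (simp add: gap_def)

lemma gap_cont: "continuous_on {p..q} gap"
  unfolding gap_def by (intro continuous_intros G.cont H.cont)

lemma fixed_iff: "x \<in> {p..q} \<Longrightarrow> H x = x \<longleftrightarrow> G x = x"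
  using HG GH by metis

lemma between:
  assumes "x \<in> {p..q}"
  shows "G x < x \<and> x < H x \<or> H x < x \<and> x < G x \<or> G x = x \<and> H x = x"
  using assms H.mono[OF assms G.into[OF assms]] H.mono[OF G.into[OF assms] assms] HG[OF assms]
    fixed_iff[OF assms] by fastforce

lemma gap_eq_0_iff: "x \<in> {p..q} \<Longrightarrow> gap x = 0 \<longleftrightarrow> G x = x"
  using between[of x] by (auto simp: gap_def)

lemma step_le_gap: "x \<in> {p..q} \<Longrightarrow> \<bar>G x - x\<bar> \<le> gap x"
  using between[of x] by (auto simp: gap_def)

text \<open>An orbit with small gaps cannot cross a region that is away from the fixed points.\<close>

lemma small_gaps_imp_small_orbit:
  assumes "0 < e"
  obtains \<delta> where "0 < \<delta>"
    "\<And>y k. y \<in> {p..q} \<Longrightarrow> (\<And>j. gap ((G ^^ j) y) < \<delta>) \<Longrightarrow> \<bar>(G ^^ k) y - y\<bar> \<le> e"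
proof -
  define h where "h = e / 3"
  have h: "0 < h" using assms by (simp add: h_def)
  define F where "F = {x \<in> {p..q}. G x = x}"
  \<comment> \<open>The points at distance at least \<open>h\<close> from all fixed points. On this
    compact set the gap has a positive minimum; if the set is empty, any positive
    \<open>\<delta>\<close> serves.\<close>
  define S where "S = {p..q} \<inter> (\<Inter>f\<in>F. {x. h \<le> \<bar>f - x\<bar>})"
  have "compact S" unfolding S_def
    by (intro compact_Int_closed closed_INT ballI closed_Collect_le continuous_intros compact_Icc)
  moreover have "continuous_on S gap"
    by (rule continuous_on_subset[OF gap_cont]) (auto simp: S_def)
  moreover have "0 < gap x" if "x \<in> S" for x
  proof -
    have "G x \<noteq> x" using that h by (force simp: S_def F_def)
    then show ?thesis using that gap_eq_0_iff[of x] gap_nonneg[of x] by (auto simp: S_def)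
  qed
  ultimately obtain \<delta> where \<delta>: "0 < \<delta>" "\<And>x. x \<in> S \<Longrightarrow> \<delta> \<le> gap x"
    by (metis continuous_attains_inf empty_iff zero_less_one)
  have "\<bar>(G ^^ k) y - y\<bar> \<le> e" if y: "y \<in> {p..q}" and small: "\<And>j. gap ((G ^^ j) y) < min h \<delta>" for y k
  proof (rule ccontr)
    assume far: "\<not> \<bar>(G ^^ k) y - y\<bar> \<le> e"
    have "\<bar>(G ^^ Suc i) y - (G ^^ i) y\<bar> < h" for i
      using step_le_gap[OF G.funpow_into[OF y], of i] small[of i] by simp
    then obtain j where j: "j \<le> k" "h \<le> \<bar>(G ^^ j) y - y\<bar>" "h \<le> \<bar>(G ^^ k) y - (G ^^ j) y\<bar>"
      using discrete_intermediate[of k "\<lambda>i. (G ^^ i) y" h] far h by (auto simp: h_def)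
    \<comment> \<open>By monotonicity no fixed point lies strictly between \<open>y\<close> and
      \<open>(G ^^ k) y\<close>, whereas \<open>(G ^^ j) y\<close> lies between them, at distance at
      least \<open>h\<close> from both.\<close>
    have "h \<le> \<bar>f - (G ^^ j) y\<bar>" if f: "f \<in> F" for f
    proof -
      have fp: "f \<in> {p..q}" "(G ^^ k) f = f" using f G.funpow_fixed by (auto simp: F_def)
      have "f \<le> y \<and> f \<le> (G ^^ k) y \<or> y \<le> f \<and> (G ^^ k) y \<le> f"
        using G.funpow_mono_on[OF fp(1) y, of k] G.funpow_mono_on[OF y fp(1), of k] fp(2) by linarith
      then show ?thesis
        using G.funpow_between[OF y j(1)] j(2,3) by linarith
    qed
    then have "(G ^^ j) y \<in> S" using G.funpow_into[OF y] by (auto simp: S_def)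
    with \<delta>(2) small[of j] show False by fastforce
  qed
  then show thesis using that[of "min h \<delta>"] h \<delta>(1) by auto
qed

text \<open>The points with gap at least \<open>\<delta>\<close> form a compact set without fixed
  points. Each \<open>y\<close> in it has the neighbourhood between \<open>H y\<close> and
  \<open>G y\<close>; these ends lie two steps apart on one orbit, so squeezing gives a local bound.
  Finitely many neighbourhoods suffice.\<close>

lemma big_gap_uniform:
  assumes "0 < e" "0 < \<delta>"
  obtains N where "\<And>y i j. y \<in> {p..q} \<Longrightarrow> \<delta> \<le> gap y \<Longrightarrow> N \<le> i \<Longrightarrow> N \<le> j \<Longrightarrow> \<bar>(G ^^ i) y - (G ^^ j) y\<bar> \<le> e"
proof -
  define S where "S = {y \<in> {p..q}. \<delta> \<le> gap y}"
  have "closed S" unfolding S_def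
    by (rule continuous_on_closed_Collect_le[OF continuous_on_const gap_cont closed_atLeastAtMost])
  moreover have "S \<subseteq> {p..q}" by (auto simp: S_def)
  ultimately have S: "compact S" using compact_Int_closed[OF compact_Icc[of p q]] by (metis inf.absorb_iff2)
  define V where "V y = {min (H y) (G y)<..<max (H y) (G y)}" for y
  have "\<exists>N. \<forall>x\<in>V y. \<forall>i\<ge>N. \<forall>j\<ge>N. \<bar>(G ^^ i) x - (G ^^ j) x\<bar> \<le> e" if "y \<in> S" for y
  proof -
    have y: "y \<in> {p..q}" using that by (auto simp: S_def)
    note Hy = H.into[OF y] and Gy = G.into[OF y]
    obtain l where l: "(\<lambda>k. (G ^^ k) (H y)) \<longlonglongrightarrow> l"
      using G.funpow_converges[OF Hy] by blast
    have "(\<lambda>k. (G ^^ Suc (Suc k)) (H y)) \<longlonglongrightarrow> l"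
      using l by (intro LIMSEQ_Suc)
    then have l': "(\<lambda>k. (G ^^ k) (G y)) \<longlonglongrightarrow> l"
      by (simp add: funpow_swap1 GH[OF y])
    have "\<exists>N. \<forall>x\<in>{min (H y) (G y)..max (H y) (G y)}. \<forall>i\<ge>N. \<forall>j\<ge>N. \<bar>(G ^^ i) x - (G ^^ j) x\<bar> \<le> e"
      using l l' Hy Gy \<open>0 < e\<close> by (intro G.funpow_squeeze) (auto simp: min_def max_def)
    then show ?thesis unfolding V_def by (meson greaterThanLessThan_subseteq_atLeastAtMost_iff order_refl subset_iff)
  qed
  then obtain N where N: "\<And>y x i j. y \<in> S \<Longrightarrow> x \<in> V y \<Longrightarrow> N y \<le> i \<Longrightarrow> N y \<le> j \<Longrightarrow> \<bar>(G ^^ i) x - (G ^^ j) x\<bar> \<le> e"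
    by metis
  have "S \<subseteq> (\<Union>y\<in>S. V y)"
  proof
    fix y assume y: "y \<in> S"
    then have "G y \<noteq> y" using gap_eq_0_iff[of y] \<open>0 < \<delta>\<close> by (auto simp: S_def)
    then have "y \<in> V y" using y between[of y] by (auto simp: V_def S_def)
    with y show "y \<in> (\<Union>y\<in>S. V y)" by blast
  qed
  then obtain C where C: "C \<subseteq> S" "finite C" "S \<subseteq> (\<Union>y\<in>C. V y)"
    using compactE_image[OF S, of S V] by (auto simp: V_def)
  define m where "m = Max (insert 0 (N ` C))"
  have m: "N y \<le> m" if "y \<in> C" for y
    unfolding m_def using C(2) that by auto
  have "\<bar>(G ^^ i) y - (G ^^ j) y\<bar> \<le> e" if y: "y \<in> S" and ij: "m \<le> i" "m \<le> j" for y i j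
  proof -
    obtain c where c: "c \<in> C" "y \<in> V c" using y C(3) by blast
    then have "N c \<le> i" "N c \<le> j" using m[OF c(1)] ij by auto
    with N c C(1) show ?thesis by blast
  qed
  then show thesis using that unfolding S_def by blast
qed

text \<open>If the gap at \<open>y\<close> is at least \<open>\<delta>\<close>, compactness applies.
  Otherwise maximality at \<open>y\<close> makes all gaps on the forward orbit small, and the orbit
  stays within \<open>e / 2\<close> of \<open>y\<close>.\<close>

lemma uniform_Cauchy:
  assumes "0 < e"
  obtains N where "\<And>y i j. y \<in> {p..q} \<Longrightarrow> (\<And>k. gap ((G ^^ k) y) \<le> gap y) \<Longrightarrow>
    N \<le> i \<Longrightarrow> N \<le> j \<Longrightarrow> \<bar>(G ^^ i) y - (G ^^ j) y\<bar> \<le> e"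
proof -
  from assms have "0 < e / 2" by simp
  then obtain \<delta> where \<delta>: "0 < \<delta>"
    "\<And>y k. y \<in> {p..q} \<Longrightarrow> (\<And>j. gap ((G ^^ j) y) < \<delta>) \<Longrightarrow> \<bar>(G ^^ k) y - y\<bar> \<le> e / 2"
    using small_gaps_imp_small_orbit by blast
  obtain N where N: "\<And>y i j. y \<in> {p..q} \<Longrightarrow> \<delta> \<le> gap y \<Longrightarrow> N \<le> i \<Longrightarrow> N \<le> j \<Longrightarrow> \<bar>(G ^^ i) y - (G ^^ j) y\<bar> \<le> e"
    using big_gap_uniform[OF assms \<delta>(1)] by blast
  have "\<bar>(G ^^ i) y - (G ^^ j) y\<bar> \<le> e"
    if y: "y \<in> {p..q}" and top: "\<And>k. gap ((G ^^ k) y) \<le> gap y" and ij: "N \<le> i" "N \<le> j" for y i j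
  proof (cases "\<delta> \<le> gap y")
    case True
    with N y ij show ?thesis by blast
  next
    case False
    then have "gap ((G ^^ k) y) < \<delta>" for k using top[of k] by linarith
    then have "\<bar>(G ^^ k) y - y\<bar> \<le> e / 2" for k using \<delta>(2) y by blast
    from this[of i] this[of j] show ?thesis by linarith
  qed
  then show thesis using that by blast
qed

section \<open>Two-sided orbits and the core\<close>

definition itr :: "int \<Rightarrow> real \<Rightarrow> real" where
  "itr k x = (if 0 \<le> k then (G ^^ nat k) x else (H ^^ nat (- k)) x)"

lemma itr_0 [simp]: "itr 0 x = x"
  by (simp add: itr_def)

lemma itr_int: "itr (int k) x = (G ^^ k) x"
  by (simp add: itr_def)

lemma itr_minus_int: "itr (- int k) x = (H ^^ k) x"
  by (cases "k = 0") (simp_all add: itr_def)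

lemma itr_into: "x \<in> {p..q} \<Longrightarrow> itr k x \<in> {p..q}"
  using G.funpow_into H.funpow_into by (simp add: itr_def)

lemma itr_cont: "continuous_on {p..q} (itr k)"
  unfolding itr_def[abs_def] using G.funpow_cont H.funpow_cont by (cases "0 \<le> k") simp_all

lemma itr_Suc:
  assumes "x \<in> {p..q}"
  shows "itr (k + 1) x = G (itr k x)"
proof (cases "0 \<le> k")
  case True
  then show ?thesis by (simp add: itr_def nat_add_distrib)
next
  case False
  then obtain n where n: "k = - int (Suc n)"
    by (metis int_cases linorder_not_le of_nat_0_le_iff)
  then have "itr (k + 1) x = itr (- int n) x" by simp
  also have "\<dots> = G (H ((H ^^ n) x))"
    using GH[OF H.funpow_into[OF assms]] by (simp add: itr_minus_int)
  also have "\<dots> = G (itr k x)" unfolding n itr_minus_int by simp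
  finally show ?thesis .
qed

lemma itr_pred: "x \<in> {p..q} \<Longrightarrow> itr (k - 1) x = H (itr k x)"
  using itr_Suc[of x "k - 1"] HG[OF itr_into, of x "k - 1"] by simp

lemma itr_add:
  assumes "x \<in> {p..q}"
  shows "itr (k + l) x = itr k (itr l x)"
proof (induction k rule: int_induct[where k = 0])
  case (step1 i)
  then show ?case
    using itr_Suc[OF assms, of "i + l"] itr_Suc[OF itr_into[OF assms], of i l] by (simp add: ac_simps)
next
  case (step2 i)
  then show ?case
    using itr_pred[OF assms, of "i + l"] itr_pred[OF itr_into[OF assms], of i l] by (simp add: algebra_simps)
qed simp

text \<open>In place of a fundamental domain: the points at which the gap is maximal along the orbit.
  Unlike a fundamental domain this is a closed condition, so it makes sense globally
  although there may be infinitely many intervals between fixed points.\<close>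

definition core :: "real set" where
  "core = {y \<in> {p..q}. \<forall>k. gap (itr k y) \<le> gap y}"

lemma compact_core: "compact core"
proof -
  have "continuous_on {p..q} (\<lambda>y. gap (itr k y))" for k
    by (rule continuous_on_compose2[OF gap_cont itr_cont]) (use itr_into in blast)
  then have "closed {y \<in> {p..q}. gap (itr k y) \<le> gap y}" for k
    by (intro continuous_on_closed_Collect_le gap_cont closed_atLeastAtMost)
  then have "compact ({p..q} \<inter> (\<Inter>k. {y \<in> {p..q}. gap (itr k y) \<le> gap y}))"
    by (intro compact_Int_closed closed_INT compact_Icc) auto
  moreover have "{p..q} \<inter> (\<Inter>k. {y \<in> {p..q}. gap (itr k y) \<le> gap y}) = core"
    by (auto simp: core_def)
  ultimately show ?thesis by simp
qed

lemma gap_funpow_tendsto_0: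
  assumes "x \<in> {p..q}"
  shows "(\<lambda>k. gap ((G ^^ k) x)) \<longlonglongrightarrow> 0"
proof -
  obtain l where l: "l \<in> {p..q}" "G l = l" "(\<lambda>k. (G ^^ k) x) \<longlonglongrightarrow> l"
    using G.funpow_converges[OF assms] by blast
  have "(\<lambda>k. gap ((G ^^ k) x)) \<longlonglongrightarrow> gap l"
    by (rule continuous_on_tendsto_compose[OF gap_cont l(3,1)]) (use G.funpow_into[OF assms] in simp)
  moreover have "gap l = 0" using l gap_eq_0_iff by blast
  ultimately show ?thesis by simp
qed

text \<open>Both ends of the orbit converge to fixed points, where the gap is 0. If
  \<open>gap x\<close> is positive, the gaps outside a finite window of times are below
  \<open>gap x\<close>, so the maximum over the window is a maximum over the whole orbit, and it is
  attained in the core.\<close>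

lemma orbit_meets_core:
  assumes x: "x \<in> {p..q}"
  obtains y k where "y \<in> core" "x = itr k y"
proof -
  have "\<exists>m. \<forall>k. gap (itr k x) \<le> gap (itr m x)"
  proof (cases "gap x = 0")
    case True
    then have "G x = x" "H x = x" using gap_eq_0_iff fixed_iff x by auto
    then have "itr k x = x" for k
      using G.funpow_fixed H.funpow_fixed by (simp add: itr_def)
    then show ?thesis by simp
  next
    case False
    then have pos: "0 < gap x" using gap_nonneg[of x] by simp
    have "\<forall>\<^sub>F k in sequentially. gap ((G ^^ k) x) < gap x \<and> gap ((H ^^ k) x) < gap x"
      using order_tendstoD(2)[OF gap_funpow_tendsto_0[OF x] pos]
        order_tendstoD(2)[OF interval_homeo.gap_funpow_tendsto_0[OF swap x, unfolded gap_swap] pos]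
      by (rule eventually_conj)
    then obtain N where N: "\<And>k. N \<le> k \<Longrightarrow> gap ((G ^^ k) x) < gap x \<and> gap ((H ^^ k) x) < gap x"
      by (auto simp: eventually_sequentially)
    define A where "A = (\<lambda>k. gap (itr k x)) ` {- int N..int N}"
    have A: "finite A" "gap (itr 0 x) \<in> A" unfolding A_def by (auto simp del: itr_0)
    then have "Max A \<in> A" using Max_in by blast
    moreover have "\<exists>m. gap (itr m x) = z" if "z \<in> A" for z
      using that by (auto simp: A_def)
    ultimately obtain m where m: "gap (itr m x) = Max A" by blast
    have "gap (itr k x) \<le> gap (itr m x)" for k
    proof (cases "k \<in> {- int N..int N}")
      case True
      then show ?thesis using A(1) unfolding m by (intro Max_ge) (auto simp: A_def)
    next
      case False
      then have "gap (itr k x) \<le> gap (itr 0 x)"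
        using N[of "nat k"] N[of "nat (- k)"] by (auto simp: itr_def intro: less_imp_le)
      also have "\<dots> \<le> gap (itr m x)" unfolding m by (rule Max_ge[OF A])
      finally show ?thesis .
    qed
    then show ?thesis by blast
  qed
  then obtain m where m: "\<And>k. gap (itr k x) \<le> gap (itr m x)" by blast
  have "itr m x \<in> core"
    using m itr_into[OF x] by (auto simp: core_def itr_add[OF x, symmetric])
  moreover have "x = itr (- m) (itr m x)"
    by (simp add: itr_add[OF x, symmetric])
  ultimately show thesis using that by blast
qed

lemma itr_uniform_Cauchy:
  assumes "0 < e"
  obtains N :: int where
    "\<And>y i j. y \<in> core \<Longrightarrow> N \<le> i \<and> N \<le> j \<or> i \<le> - N \<and> j \<le> - N \<Longrightarrow> \<bar>itr i y - itr j y\<bar> \<le> e"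
proof -
  obtain N1 where N1: "\<And>y i j. y \<in> {p..q} \<Longrightarrow> (\<And>k. gap ((G ^^ k) y) \<le> gap y) \<Longrightarrow>
    N1 \<le> i \<Longrightarrow> N1 \<le> j \<Longrightarrow> \<bar>(G ^^ i) y - (G ^^ j) y\<bar> \<le> e"
    using uniform_Cauchy[OF assms] by blast
  obtain N2 where N2: "\<And>y i j. y \<in> {p..q} \<Longrightarrow> (\<And>k. gap ((H ^^ k) y) \<le> gap y) \<Longrightarrow>
    N2 \<le> i \<Longrightarrow> N2 \<le> j \<Longrightarrow> \<bar>(H ^^ i) y - (H ^^ j) y\<bar> \<le> e"
    using interval_homeo.uniform_Cauchy[OF swap assms, unfolded gap_swap] by blast
  \<comment> \<open>The added 1 keeps \<open>i\<close> and \<open>j\<close> away from 0, so that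
    their sign decides between \<open>G\<close> and \<open>H\<close>.\<close>
  have "\<bar>itr i y - itr j y\<bar> \<le> e"
    if y: "y \<in> core" and ij: "int (max N1 N2 + 1) \<le> i \<and> int (max N1 N2 + 1) \<le> j \<or>
      i \<le> - int (max N1 N2 + 1) \<and> j \<le> - int (max N1 N2 + 1)" for y i j
  proof -
    have "gap ((G ^^ k) y) \<le> gap y" "gap ((H ^^ k) y) \<le> gap y" for k
      using y by (auto simp: core_def itr_int[symmetric] itr_minus_int[symmetric])
    moreover have "y \<in> {p..q}" using y by (simp add: core_def)
    ultimately show ?thesis
      using ij N1[of y "nat i" "nat j"] N2[of y "nat (- i)" "nat (- j)"] by (auto simp: itr_def)
  qed
  then show thesis using that by blast
qed

end

text \<open>\<open>D r\<close> holds base points and \<open>E r k\<close> moves them to time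
  \<open>k\<close>. Class \<open>False\<close> consists of two-sided orbits in
  \<open>{p..q}\<close>, class \<open>True\<close> of forward orbits that cover the rest; for the
  latter only times \<open>0 \<le> k\<close> are dynamically meaningful.\<close>

lemma increasing_orbit_coding:
  fixes G :: "real \<Rightarrow> real"
  assumes ab: "a \<le> b" and cont: "continuous_on {a..b} G" and smono: "strict_mono_on {a..b} G"
    and into: "G ` {a..b} \<subseteq> {a..b}"
  obtains D :: "bool \<Rightarrow> real set" and E :: "bool \<Rightarrow> int \<Rightarrow> real \<Rightarrow> real" where
    "\<And>r. compact (D r)" "\<And>r. D r \<noteq> {}"
    "\<And>r k. continuous_on (D r) (E r k)"
    "\<And>r k y. y \<in> D r \<Longrightarrow> E r k y \<in> {a..b}"
    "\<And>r k y. y \<in> D r \<Longrightarrow> r \<longrightarrow> 0 \<le> k \<Longrightarrow> E r (k + 1) y = G (E r k y)"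
    "\<And>e. 0 < e \<Longrightarrow> \<exists>N. \<forall>r. \<forall>y\<in>D r. \<forall>i j.
       N \<le> i \<and> N \<le> j \<or> i \<le> - N \<and> j \<le> - N \<longrightarrow> \<bar>E r i y - E r j y\<bar> \<le> e"
    "\<And>x. x \<in> {a..b} \<Longrightarrow> \<exists>r k. (r \<longrightarrow> 0 \<le> k) \<and> x \<in> E r k ` D r"
proof -
  have mono: "G x \<le> G y" if "x \<in> {a..b}" "y \<in> {a..b}" "x \<le> y" for x y
    using smono that by (meson strict_mono_on_leD)
  interpret I: mono_interval_map a b G
    using cont into mono by unfold_locales (blast | simp)+
  have ab': "a \<in> {a..b}" "b \<in> {a..b}" using ab by auto
  obtain p where p: "p \<in> {a..b}" "G p = p" "(\<lambda>k. (G ^^ k) a) \<longlonglongrightarrow> p"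
    using I.funpow_converges[OF ab'(1)] by blast
  obtain q where q: "q \<in> {a..b}" "G q = q" "(\<lambda>k. (G ^^ k) b) \<longlonglongrightarrow> q"
    using I.funpow_converges[OF ab'(2)] by blast
  have pq: "p \<le> q"
    using I.funpow_mono_on[OF ab' ab] by (intro LIMSEQ_le[OF p(3) q(3)]) auto
  have sub: "{p..q} \<subseteq> {a..b}" using p(1) q(1) by auto
  have Gcont: "continuous_on {p..q} G" by (rule continuous_on_subset[OF cont sub])
  have inj: "inj_on G {p..q}"
    using strict_mono_on_imp_inj_on[OF smono] sub inj_on_subset by blast
  \<comment> \<open>The ends \<open>p\<close> and \<open>q\<close> are fixed, so monotonicity gives
    one inclusion and the intermediate value theorem the other.\<close>
  have image: "G ` {p..q} = {p..q}"
  proof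
    show "G ` {p..q} \<subseteq> {p..q}"
    proof
      fix y assume "y \<in> G ` {p..q}"
      then obtain x where "x \<in> {p..q}" "y = G x" by blast
      then show "y \<in> {p..q}"
        using mono[of p x] mono[of x q] p q sub by auto
    qed
    show "{p..q} \<subseteq> G ` {p..q}"
    proof
      fix y assume "y \<in> {p..q}"
      then have "\<exists>x. p \<le> x \<and> x \<le> q \<and> G x = y"
        using p q pq Gcont by (intro IVT') auto
      then show "y \<in> G ` {p..q}" by auto
    qed
  qed
  define H where "H = the_inv_into {p..q} G"
  have HG: "H (G x) = x" if "x \<in> {p..q}" for x
    unfolding H_def using inj that by (rule the_inv_into_f_f)
  have GH: "G (H x) = x" if "x \<in> {p..q}" for x
    unfolding H_def using inj image that by (auto intro: f_the_inv_into_f)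
  have Hinto: "H x \<in> {p..q}" if "x \<in> {p..q}" for x
    unfolding H_def using the_inv_into_into[OF inj _ order_refl] image that by auto
  have Hcont: "continuous_on {p..q} H"
    using continuous_on_inv[OF Gcont compact_Icc] HG image by metis
  have Hmono: "H x \<le> H y" if xy: "x \<in> {p..q}" "y \<in> {p..q}" "x \<le> y" for x y
  proof (rule ccontr)
    assume "\<not> H x \<le> H y"
    then have "G (H y) < G (H x)"
      using Hinto[OF xy(1)] Hinto[OF xy(2)] sub by (intro strict_mono_onD[OF smono]) auto
    with xy GH show False by auto
  qed
  interpret Z: interval_homeo p q G H
  proof
    show "G x \<in> {p..q}" if "x \<in> {p..q}" for x using image that by blast
    show "G x \<le> G y" if "x \<in> {p..q}" "y \<in> {p..q}" "x \<le> y" for x y using mono sub that by blast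
  qed (use Gcont Hcont Hinto Hmono HG GH in auto)
  define D where "D r = (if r then {a..G a} \<union> {G b..b} else Z.core)" for r
  \<comment> \<open>In class \<open>True\<close>, \<open>nat k\<close> freezes the point at negative
    times, which makes the Cauchy condition at the negative end trivial.\<close>
  define E where "E r k = (if r then G ^^ nat k else Z.itr k)" for r k
  have Dsub: "D True \<subseteq> {a..b}" "D False \<subseteq> {p..q}"
    using I.into[OF ab'(1)] I.into[OF ab'(2)] by (auto simp: D_def Z.core_def)
  show thesis
  proof
    show "compact (D r)" for r
      by (auto simp: D_def Z.compact_core intro: compact_Un)
    show "D r \<noteq> {}" for r
    proof (cases r)
      case True
      then show ?thesis using I.into[OF ab'(1)] by (auto simp: D_def)
    next
      case False
      obtain y k where "y \<in> Z.core" using Z.orbit_meets_core[of p] pq by auto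
      with False show ?thesis by (auto simp: D_def)
    qed
    show "continuous_on (D r) (E r k)" for r k
      using continuous_on_subset[OF I.funpow_cont Dsub(1)] continuous_on_subset[OF Z.itr_cont Dsub(2)]
      by (cases r) (simp_all add: E_def)
    show "E r k y \<in> {a..b}" if "y \<in> D r" for r k y
    proof (cases r)
      case True
      then have "y \<in> {a..b}" using that Dsub(1) by auto
      with True show ?thesis using I.funpow_into by (simp add: E_def)
    next
      case False
      then have "y \<in> {p..q}" using that Dsub(2) by auto
      then have "Z.itr k y \<in> {a..b}" using Z.itr_into sub by blast
      with False show ?thesis by (simp add: E_def)
    qed
    show "E r (k + 1) y = G (E r k y)" if "y \<in> D r" "r \<longrightarrow> 0 \<le> k" for r k y
    proof (cases r)
      case True
      with that show ?thesis by (simp add: E_def nat_add_distrib)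
    next
      case False
      then have "y \<in> {p..q}" using that Dsub(2) by auto
      with False show ?thesis by (simp add: E_def Z.itr_Suc)
    qed
    show "\<exists>r k. (r \<longrightarrow> 0 \<le> k) \<and> x \<in> E r k ` D r" if x: "x \<in> {a..b}" for x
    proof (cases "x \<in> {p..q}")
      case True
      then obtain y k where "y \<in> Z.core" "x = Z.itr k y" by (rule Z.orbit_meets_core)
      then show ?thesis by (intro exI[of _ False] exI[of _ k]) (auto simp: D_def E_def)
    next
      case False
      then obtain y k where "y \<in> D True" "x = (G ^^ k) y"
        using I.forward_sweep[OF x p(3) q(3)] unfolding D_def by (metis (full_types))
      then show ?thesis by (intro exI[of _ True] exI[of _ "int k"]) (auto simp: E_def)
    qed
    fix e :: real assume e: "0 < e"
    obtain N1 where N1: "\<And>y i j. y \<in> Z.core \<Longrightarrow>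
        N1 \<le> i \<and> N1 \<le> j \<or> i \<le> - N1 \<and> j \<le> - N1 \<Longrightarrow> \<bar>Z.itr i y - Z.itr j y\<bar> \<le> e"
      using Z.itr_uniform_Cauchy[OF e] by blast
    have "D True = {a..G a} \<union> {G b..b}" by (simp add: D_def)
    then obtain N2 where N2: "\<And>y i j. y \<in> D True \<Longrightarrow> N2 \<le> i \<Longrightarrow> N2 \<le> j \<Longrightarrow> \<bar>(G ^^ i) y - (G ^^ j) y\<bar> \<le> e"
      using I.forward_sweep_uniform[OF ab e] by blast
    define N where "N = max N1 (int N2)"
    have N: "N1 \<le> N" "int N2 \<le> N" by (auto simp: N_def)
    have "\<bar>E r i y - E r j y\<bar> \<le> e"
      if y: "y \<in> D r" and ij: "N \<le> i \<and> N \<le> j \<or> i \<le> - N \<and> j \<le> - N" for r y i j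
    proof (cases r)
      case False
      have "N1 \<le> i \<and> N1 \<le> j \<or> i \<le> - N1 \<and> j \<le> - N1" using ij N by linarith
      with False y N1 show ?thesis by (simp add: D_def E_def)
    next
      case True
      show ?thesis
      proof (cases "N \<le> i \<and> N \<le> j")
        case T: True
        then have "N2 \<le> nat i" "N2 \<le> nat j" using N by auto
        with N2 y True show ?thesis by (simp add: E_def)
      next
        case False
        then have "nat i = 0" "nat j = 0" using ij N by auto
        with True e show ?thesis by (simp add: E_def)
      qed
    qed
    then show "\<exists>N. \<forall>r. \<forall>y\<in>D r. \<forall>i j.
       N \<le> i \<and> N \<le> j \<or> i \<le> - N \<and> j \<le> - N \<longrightarrow> \<bar>E r i y - E r j y\<bar> \<le> e" by blast
  qed
qed

section \<open>The automaton\<close>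

text \<open>
  Tape 0 codes a point \<open>y\<close>, tape 4 its class, and both never change. Tape 3 alternates between
  0 and 1, so that the other tapes move on every second step only. In class 0 the leading zeros of the
  input tape 1 are the time to wait until the orbit arrives at \<open>y\<close>. After that, and always
  in class 1, the leading ones of the output tape 2 are the time since the orbit left \<open>y\<close>.
\<close>

definition orbit_automaton :: "(nat, nat) automaton" where
  "orbit_automaton = \<lparr>tapes = {0, 1, 2, 3, 4}, alphabet = (\<lambda>_. {0, 1}),
     trans = (\<lambda>t q.
       if q 3 = 0 then (if t = 3 then Push 1 else Stay)
       else if t = 1 then (if q 1 = 0 then Shift else Stay)
       else if t = 2 then (if q 4 = 0 \<and> q 1 = 0 then Push 0 else Push 1)
       else if t = 3 then Push 0
       else Stay)\<rparr>"

lemma tapes_orbit_automaton: "tapes orbit_automaton = {0, 1, 2, 3, 4}"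
  by (simp add: orbit_automaton_def)

lemma finite_automaton_orbit_automaton: "finite_automaton orbit_automaton"
  by (auto simp: finite_automaton_def automaton_def input_tape_def output_tape_def orbit_automaton_def)

lemma step_orbit_automaton_0:
  assumes "u 3 0 = 0"
  shows "step orbit_automaton u 3 = case_nat 1 (u 3)"
    and "t \<in> {0, 1, 2, 4} \<Longrightarrow> step orbit_automaton u t = u t"
  using assms by (auto simp: step_def heads_def orbit_automaton_def)

lemma step_orbit_automaton_1:
  assumes "u 3 0 \<noteq> 0"
  shows "step orbit_automaton u 3 = case_nat 0 (u 3)"
    and "t \<in> {0, 4} \<Longrightarrow> step orbit_automaton u t = u t"
    and "step orbit_automaton u 1 = (if u 1 0 = 0 then (\<lambda>i. u 1 (Suc i)) else u 1)"
    and "step orbit_automaton u 2 = case_nat (if u 4 0 = 0 \<and> u 1 0 = 0 then 0 else 1) (u 2)"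
  using assms by (auto simp: step_def heads_def orbit_automaton_def)

text \<open>The initial run of \<open>c\<close>, cut off at \<open>n\<close>: finite also on a
  constant tape and determined by the first \<open>n\<close> cells.\<close>

fun lead :: "'a \<Rightarrow> nat \<Rightarrow> (nat \<Rightarrow> 'a) \<Rightarrow> nat" where
  "lead c 0 u = 0"
| "lead c (Suc n) u = (if u 0 = c then Suc (lead c n (\<lambda>i. u (Suc i))) else 0)"

text \<open>A larger cutoff changes the value only if the run reached the old cutoff.\<close>

lemma lead_stable: "n \<le> m \<Longrightarrow> lead c m u = lead c n u \<or> n \<le> lead c m u \<and> lead c n u = n"
proof (induction n arbitrary: m u)
  case (Suc n)
  then obtain l where "m = Suc l" "n \<le> l" by (cases m) auto
  with Suc.IH[of l "\<lambda>i. u (Suc i)"] show ?case by auto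
qed simp

lemma lead_eq_0: "u 0 \<noteq> c \<Longrightarrow> lead c n u = 0"
  by (cases n) auto

lemma lead_cong: "(\<And>i. i < n \<Longrightarrow> u i = v i) \<Longrightarrow> lead c n u = lead c n v"
proof (induction n arbitrary: u v)
  case (Suc n)
  from Suc.prems[of 0] Suc.IH[of "\<lambda>i. u (Suc i)" "\<lambda>i. v (Suc i)"] Suc.prems show ?case by simp
qed simp

lemma lead_threshold:
  assumes "c \<noteq> d"
  shows "lead c n (\<lambda>i. if i < k then c else d) = min n k"
proof (induction n arbitrary: k)
  case (Suc n)
  then show ?case using assms by (cases k) (simp_all add: lead_eq_0)
qed simp

text \<open>Orbit time as a point of the two-point compactification of the integers, cut off at
  \<open>n\<close>. An endless wait or an endless run encodes one of the two infinite times.\<close>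

definition clock :: "nat \<Rightarrow> (nat \<Rightarrow> nat \<Rightarrow> nat) \<Rightarrow> int" where
  "clock n u = (if u 4 0 = 0 \<and> u 1 0 = 0 then - int (lead 0 n (u 1)) else int (lead 1 n (u 2)))"

text \<open>Two cutoffs give the same time or times beyond \<open>n\<close> on the same side, which
  are the cases that a uniform Cauchy bound on \<open>E\<close> can handle.\<close>

lemma clock_stable:
  assumes "n \<le> m"
  shows "clock m u = clock n u \<or> int n \<le> clock m u \<and> int n \<le> clock n u \<or>
    clock m u \<le> - int n \<and> clock n u \<le> - int n"
  using lead_stable[OF assms, of 0 "u 1"] lead_stable[OF assms, of 1 "u 2"] by (auto simp: clock_def)

text \<open>The extra cell is there because the heads of tapes 1 and 4 select the branch even for
  \<open>n = 0\<close>.\<close>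

lemma clock_cong: "agree orbit_automaton (Suc n) u v \<Longrightarrow> clock n u = clock n v"
  using lead_cong[of n "u 1" "v 1"] lead_cong[of n "u 2" "v 2"]
  by (auto simp: clock_def agree_def tapes_orbit_automaton)

lemma clock_step_idle: "u 3 0 = 0 \<Longrightarrow> clock n (step orbit_automaton u) = clock n u"
  by (auto simp: clock_def step_orbit_automaton_0(2))

text \<open>The shift consumes one leading zero and with it one unit of precision. When the last
  zero is gone, the 0 just written on tape 2 makes the run start at time 0.\<close>

lemma clock_step_wait:
  assumes "u 3 0 \<noteq> 0" "u 4 0 = 0" "u 1 0 = 0"
  shows "clock n (step orbit_automaton u) = clock (Suc n) u + 1"
  using assms step_orbit_automaton_1[of u, OF assms(1)] by (simp add: clock_def lead_eq_0)

text \<open>The pushed 1 lengthens the run, so precision grows by one. Nonnegativity meets the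
  condition under which \<open>E\<close> advances in class 1.\<close>

lemma clock_step_run:
  assumes "u 3 0 \<noteq> 0" "u 4 0 \<noteq> 0 \<or> u 1 0 \<noteq> 0"
  shows "clock (Suc n) (step orbit_automaton u) = clock n u + 1" and "0 \<le> clock n u"
  using assms step_orbit_automaton_1[of u, OF assms(1)] by (auto simp: clock_def)

text \<open>The factor map decodes class, base point and time, takes the limit over the cutoffs, and
  applies \<open>g\<close> once more in the middle of a double step.\<close>

lemma orbit_coding_imp_factor:
  fixes g :: "real \<Rightarrow> real" and D :: "bool \<Rightarrow> real set" and E :: "bool \<Rightarrow> int \<Rightarrow> real \<Rightarrow> real"
  assumes g: "continuous_on {a..b} g" "g ` {a..b} \<subseteq> {a..b}"
    and D: "\<And>r. compact (D r)" "\<And>r. D r \<noteq> {}"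
    and E_cont: "\<And>r k. continuous_on (D r) (E r k)"
    and E_into: "\<And>r k y. y \<in> D r \<Longrightarrow> E r k y \<in> {a..b}"
    and E_Suc: "\<And>r k y. y \<in> D r \<Longrightarrow> r \<longrightarrow> 0 \<le> k \<Longrightarrow> E r (k + 1) y = g (g (E r k y))"
    and E_Cauchy: "\<And>e. 0 < e \<Longrightarrow> \<exists>N. \<forall>r. \<forall>y\<in>D r. \<forall>i j.
       N \<le> i \<and> N \<le> j \<or> i \<le> - N \<and> j \<le> - N \<longrightarrow> \<bar>E r i y - E r j y\<bar> \<le> e"
    and E_cover: "\<And>x. x \<in> {a..b} \<Longrightarrow> \<exists>r k. (r \<longrightarrow> 0 \<le> k) \<and> x \<in> E r k ` D r"
  shows "is_factor (submetric euclidean_metric {a..b}) g (config_metric orbit_automaton) (step orbit_automaton)"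
proof -
  define coding where "coding r \<psi> \<longleftrightarrow> (\<forall>s. \<psi> s \<in> D r) \<and>
      (\<forall>y\<in>D r. \<exists>s. range s \<subseteq> {0, 1} \<and> \<psi> s = y) \<and>
      (\<forall>e>0. \<exists>n. \<forall>s s'. (\<forall>i<n. s i = s' i) \<longrightarrow> \<bar>\<psi> s - \<psi> s'\<bar> < e)"
    for r and \<psi> :: "(nat \<Rightarrow> nat) \<Rightarrow> real"
  have "\<exists>\<psi>. coding r \<psi>" for r
  proof (rule binary_coding[OF D(1,2), of r])
    fix \<psi> :: "(nat \<Rightarrow> nat) \<Rightarrow> real"
    assume "\<And>s. \<psi> s \<in> D r" "\<And>y. y \<in> D r \<Longrightarrow> \<exists>s. range s \<subseteq> {0, 1} \<and> \<psi> s = y"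
      "\<And>e. 0 < e \<Longrightarrow> \<exists>n. \<forall>s s'. (\<forall>i<n. s i = s' i) \<longrightarrow> \<bar>\<psi> s - \<psi> s'\<bar> < e"
    then have "coding r \<psi>" unfolding coding_def by simp
    then show "\<exists>\<psi>. coding r \<psi>" by (rule exI[of "coding r"])
  qed
  then obtain \<psi> where \<psi>: "\<And>r. coding r (\<psi> r)" by metis
  have \<psi>_in: "\<psi> r s \<in> D r" for r s
    using \<psi>[of r] unfolding coding_def by blast
  have \<psi>_onto: "\<exists>s. range s \<subseteq> {0, 1} \<and> \<psi> r s = y" if "y \<in> D r" for r y
    using \<psi>[of r] that unfolding coding_def by blast
  have \<psi>_cont: "\<exists>n. \<forall>s s'. (\<forall>i<n. s i = s' i) \<longrightarrow> \<bar>\<psi> r s - \<psi> r s'\<bar> < e" if "0 < e" for r e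
    using \<psi>[of r] that unfolding coding_def by blast
  \<comment> \<open>The decoded position at cutoff \<open>n\<close>. Its limit supplies values at
    infinite times, where \<open>E\<close> is undefined.\<close>
  define pos where "pos n u = (let r = u 4 0 \<noteq> 0 in E r (clock n u) (\<psi> r (u 0)))"
    for n and u :: "nat \<Rightarrow> nat \<Rightarrow> nat"
  have pos_Cauchy: "\<exists>n. \<forall>u. \<forall>m\<ge>n. \<bar>pos m u - pos n u\<bar> \<le> e" if e: "0 < e" for e
  proof -
    obtain N where N: "\<And>r y i j. y \<in> D r \<Longrightarrow> N \<le> i \<and> N \<le> j \<or> i \<le> - N \<and> j \<le> - N \<Longrightarrow>
        \<bar>E r i y - E r j y\<bar> \<le> e"
      using E_Cauchy[OF e] by blast
    have "\<bar>pos m u - pos (nat N) u\<bar> \<le> e" if m: "nat N \<le> m" for u m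
    proof -
      consider "clock m u = clock (nat N) u" |
        "N \<le> clock m u \<and> N \<le> clock (nat N) u \<or> clock m u \<le> - N \<and> clock (nat N) u \<le> - N"
        using clock_stable[OF m, of u] by linarith
      then show ?thesis
        by cases (use e N[OF \<psi>_in] in \<open>simp_all add: pos_def Let_def\<close>)
    qed
    then show ?thesis by blast
  qed
  define lpos where "lpos u = lim (\<lambda>n. pos n u)" for u
  have lpos: "(\<lambda>n. pos n u) \<longlonglongrightarrow> lpos u" for u
  proof -
    have "Cauchy (\<lambda>n. pos n u)"
    proof (rule metric_CauchyI)
      fix e :: real assume "0 < e"
      then have "0 < e / 3" by simp
      then obtain n where n: "\<And>m. m \<ge> n \<Longrightarrow> \<bar>pos m u - pos n u\<bar> \<le> e / 3" using pos_Cauchy by blast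
      have "dist (pos i u) (pos j u) < e" if "i \<ge> n" "j \<ge> n" for i j
        using n[OF that(1)] n[OF that(2)] \<open>0 < e\<close> unfolding dist_real_def by linarith
      then show "\<exists>M. \<forall>i\<ge>M. \<forall>j\<ge>M. dist (pos i u) (pos j u) < e" by blast
    qed
    then show ?thesis
      unfolding lpos_def using Cauchy_convergent_iff convergent_LIMSEQ_iff by blast
  qed
  have pos_in: "pos n u \<in> {a..b}" for n u
    using E_into[OF \<psi>_in] by (simp add: pos_def Let_def)
  have lpos_in: "lpos u \<in> {a..b}" for u
    using closed_sequentially[OF closed_atLeastAtMost _ lpos] pos_in by blast
  have lpos_close: "\<exists>n. \<forall>u. \<bar>lpos u - pos n u\<bar> \<le> e" if e: "0 < e" for e
  proof -
    obtain n where n: "\<And>u m. m \<ge> n \<Longrightarrow> \<bar>pos m u - pos n u\<bar> \<le> e" using pos_Cauchy[OF e] by blast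
    have "\<bar>lpos u - pos n u\<bar> \<le> e" for u
    proof (rule LIMSEQ_le_const2)
      show "(\<lambda>m. \<bar>pos m u - pos n u\<bar>) \<longlonglongrightarrow> \<bar>lpos u - pos n u\<bar>"
        by (intro tendsto_intros lpos)
    qed (use n in blast)
    then show ?thesis by blast
  qed
  \<comment> \<open>An \<open>e / 3\<close> argument: \<open>pos n\<close> approximates
    \<open>lpos\<close> uniformly, and a finite prefix fixes class and clock, so only the continuity
    of a single \<open>E r k\<close> and of \<open>\<psi> r\<close> remains.\<close>
  have lpos_cont: "\<exists>n. \<forall>v. agree orbit_automaton n u v \<longrightarrow> \<bar>lpos v - lpos u\<bar> < e" if e: "0 < e" for u e
  proof -
    have "0 < e / 3" using e by simp
    then obtain n where n: "\<And>u. \<bar>lpos u - pos n u\<bar> \<le> e / 3" using lpos_close by blast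
    define r where "r = (u 4 0 \<noteq> 0)"
    define k where "k = clock n u"
    obtain d where d: "0 < d"
      "\<And>y. y \<in> D r \<Longrightarrow> \<bar>y - \<psi> r (u 0)\<bar> < d \<Longrightarrow> \<bar>E r k y - E r k (\<psi> r (u 0))\<bar> < e / 3"
      using E_cont[of r k] \<psi>_in[of r "u 0"] \<open>0 < e / 3\<close> unfolding continuous_on_iff dist_real_def by metis
    obtain m where m: "\<And>s s'. (\<forall>i<m. s i = s' i) \<Longrightarrow> \<bar>\<psi> r s - \<psi> r s'\<bar> < d"
      using \<psi>_cont[OF d(1)] by blast
    have "\<bar>lpos v - lpos u\<bar> < e" if v: "agree orbit_automaton (max m (Suc n)) u v" for v
    proof -
      have "agree orbit_automaton (Suc n) u v" using v by (auto simp: agree_def)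
      then have "clock n v = k" "(v 4 0 \<noteq> 0) = r"
        using clock_cong[of n u v] by (auto simp: k_def r_def agree_def tapes_orbit_automaton)
      then have pos: "pos n v = E r k (\<psi> r (v 0))" "pos n u = E r k (\<psi> r (u 0))"
        by (simp_all add: pos_def Let_def r_def k_def)
      have "\<bar>\<psi> r (v 0) - \<psi> r (u 0)\<bar> < d"
        using v by (intro m) (auto simp: agree_def tapes_orbit_automaton)
      then have "\<bar>pos n v - pos n u\<bar> < e / 3" unfolding pos by (intro d(2) \<psi>_in)
      with n[of u] n[of v] show ?thesis by linarith
    qed
    then show ?thesis by blast
  qed
  have lpos_step0: "lpos (step orbit_automaton u) = lpos u" if "u 3 0 = 0" for u
    by (simp add: lpos_def pos_def clock_step_idle that step_orbit_automaton_0(2)[of u, OF that])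
  have g_in: "g x \<in> {a..b}" if "x \<in> {a..b}" for x using g(2) that by blast
  have gg: "(\<lambda>n. g (g (pos n u))) \<longlonglongrightarrow> g (g (lpos u))" for u
  proof -
    have *: "(\<lambda>n. g (pos n u)) \<longlonglongrightarrow> g (lpos u)"
      by (rule continuous_on_tendsto_compose[OF g(1) lpos lpos_in]) (use pos_in in simp)
    show ?thesis
      by (intro continuous_on_tendsto_compose[OF g(1) *] always_eventually allI g_in lpos_in pos_in)
  qed
  \<comment> \<open>Waiting relates cutoff \<open>Suc n\<close> before the step to \<open>n\<close>
    after it, running relates \<open>n\<close> to \<open>Suc n\<close>. Either offset disappears in
    the limit.\<close>
  have lpos_step1: "lpos (step orbit_automaton u) = g (g (lpos u))" if u: "u 3 0 \<noteq> 0" for u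
  proof -
    define v where "v = step orbit_automaton u"
    define r where "r = (u 4 0 \<noteq> 0)"
    have v: "pos n v = E r (clock n v) (\<psi> r (u 0))" for n
      using step_orbit_automaton_1(2)[of u, OF u] by (simp add: v_def pos_def r_def Let_def)
    have u': "pos n u = E r (clock n u) (\<psi> r (u 0))" for n
      by (simp add: pos_def r_def Let_def)
    show ?thesis
    proof (cases "u 4 0 = 0 \<and> u 1 0 = 0")
      case True
      then have "pos n v = g (g (pos (Suc n) u))" for n
        unfolding v u' using clock_step_wait[of u n, OF u] E_Suc[OF \<psi>_in] by (simp add: v_def r_def)
      then have "(\<lambda>n. pos n v) \<longlonglongrightarrow> g (g (lpos u))" using LIMSEQ_Suc[OF gg[of u]] by simp
      with lpos show ?thesis unfolding v_def by (rule LIMSEQ_unique)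
    next
      case False
      then have "pos (Suc n) v = g (g (pos n u))" for n
        unfolding v u' using clock_step_run[of u n, OF u] E_Suc[OF \<psi>_in] by (auto simp: v_def)
      then have "(\<lambda>n. pos (Suc n) v) \<longlonglongrightarrow> g (g (lpos u))" using gg[of u] by simp
      with LIMSEQ_Suc[OF lpos] show ?thesis unfolding v_def by (rule LIMSEQ_unique)
    qed
  qed
  \<comment> \<open>A nonzero head of tape 3 means that the first of two applications of
    \<open>g\<close> is done while the clock has not yet advanced.\<close>
  define \<phi> where "\<phi> u = (if u 3 0 = 0 then lpos u else g (lpos u))" for u
  have fin: "finite (tapes orbit_automaton)" by (simp add: tapes_orbit_automaton)
  have \<phi>_in: "\<phi> u \<in> {a..b}" for u
    using lpos_in[of u] g_in[OF lpos_in[of u]] by (simp add: \<phi>_def)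
  have top: "mtopology_of (submetric euclidean_metric {a..b}) = top_of_set {a..b}"
    by (simp add: mtopology_of_submetric)
  have "continuous_map (mtopology_of (config_metric orbit_automaton))
      (mtopology_of (submetric euclidean_metric {a..b})) \<phi>"
  proof (rule continuous_map_from_configs[OF fin])
    show "\<phi> u \<in> mspace (submetric euclidean_metric {a..b})" for u
      using \<phi>_in by simp
    fix u and e :: real assume e: "0 < e"
    obtain d where d: "0 < d" "\<And>y. y \<in> {a..b} \<Longrightarrow> \<bar>y - lpos u\<bar> < d \<Longrightarrow> \<bar>g y - g (lpos u)\<bar> < e"
      using g(1) lpos_in[of u] e unfolding continuous_on_iff dist_real_def by metis
    have "0 < min d e" using d(1) e by simp
    then obtain n where n: "\<And>v. agree orbit_automaton n u v \<Longrightarrow> \<bar>lpos v - lpos u\<bar> < min d e"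
      using lpos_cont by blast
    \<comment> \<open>At least one common cell ensures that \<open>u\<close> and \<open>v\<close>
      use the same branch of \<open>\<phi>\<close>.\<close>
    have "\<bar>\<phi> v - \<phi> u\<bar> < e" if v: "agree orbit_automaton (max 1 n) u v" for v
    proof -
      have "agree orbit_automaton n u v" using v by (auto simp: agree_def)
      then have "\<bar>lpos v - lpos u\<bar> < min d e" by (rule n)
      moreover have "v 3 0 = u 3 0" using v by (auto simp: agree_def tapes_orbit_automaton)
      ultimately show ?thesis using d(2)[OF lpos_in, of v] by (simp add: \<phi>_def)
    qed
    then show "\<exists>n. \<forall>v\<in>configs orbit_automaton. agree orbit_automaton n u v \<longrightarrow>
        mdist (submetric euclidean_metric {a..b}) (\<phi> u) (\<phi> v) < e"
      by (intro exI[of _ "max 1 n"]) (auto simp: dist_real_def abs_minus_commute)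
  qed
  moreover have "\<phi> ` mspace (config_metric orbit_automaton) = mspace (submetric euclidean_metric {a..b})"
  proof -
    have "x \<in> \<phi> ` configs orbit_automaton" if x: "x \<in> {a..b}" for x
    proof -
      obtain r k y where rk: "r \<longrightarrow> 0 \<le> k" and y: "y \<in> D r" "x = E r k y"
        using E_cover[OF x] by blast
      obtain s where s: "range s \<subseteq> {0, 1}" "\<psi> r s = y" using \<psi>_onto[OF y(1)] by blast
      \<comment> \<open>A negative time is stored as \<open>- k\<close> zeros on tape 1, a positive
        one as \<open>k\<close> ones on tape 2. The clock then equals \<open>k\<close> from cutoff
        \<open>\<bar>k\<bar>\<close> on, and tape 3 selects the branch without the extra
        \<open>g\<close>.\<close>
      define u :: "nat \<Rightarrow> nat \<Rightarrow> nat" where "u = (\<lambda>t\<in>{0, 1, 2, 3, 4}.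
        if t = 0 then s
        else if t = 1 then (\<lambda>i. if i < nat (- k) then 0 else 1)
        else if t = 2 then (\<lambda>i. if i < nat k then 1 else 0)
        else if t = 3 then (\<lambda>_. 0)
        else (\<lambda>_. if r then 1 else 0))"
      have u: "u \<in> configs orbit_automaton"
        using s(1) by (auto simp: u_def configs_def orbit_automaton_def PiE_def)
      have clock: "clock n u = k" if "nat \<bar>k\<bar> \<le> n" for n
        using rk that lead_threshold[of "0 :: nat" 1 n "nat (- k)"] lead_threshold[of "1 :: nat" 0 n "nat k"]
        by (auto simp: clock_def u_def)
      have "(u 4 0 \<noteq> 0) = r" "u 0 = s" by (simp_all add: u_def)
      then have "pos n u = x" if "nat \<bar>k\<bar> \<le> n" for n
        using s(2) y(2) clock[OF that] by (simp only: pos_def Let_def)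
      then have "(\<lambda>n. pos n u) \<longlonglongrightarrow> x"
        by (intro tendsto_eventually) (auto simp: eventually_sequentially)
      then have "lpos u = x" using lpos by (rule LIMSEQ_unique[symmetric])
      then have "\<phi> u = x" by (simp add: \<phi>_def u_def)
      with u show ?thesis by blast
    qed
    with \<phi>_in show ?thesis by (auto simp: mspace_config_metric[OF fin])
  qed
  moreover have "g (\<phi> u) = \<phi> (step orbit_automaton u)" for u
    using lpos_step0[of u] lpos_step1[of u] step_orbit_automaton_0(1)[of u] step_orbit_automaton_1(1)[of u]
    by (cases "u 3 0 = 0") (auto simp: \<phi>_def)
  moreover have "dynamical_system (submetric euclidean_metric {a..b}) g"
    using g by (auto simp: dynamical_system_def top compact_space_subtopology)
  moreover have "dynamical_system (config_metric orbit_automaton) (step orbit_automaton)"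
    using finite_automaton_orbit_automaton by (intro dynamical_system_automaton) (simp add: finite_automaton_def)
  ultimately show ?thesis unfolding is_factor_def by blast
qed

section \<open>Reduction to an increasing map\<close>

theorem theorem2:
  fixes a b :: real and g :: "real \<Rightarrow> real"
  assumes "a \<le> b"
    and "g ` {a..b} \<subseteq> {a..b}"
    and "\<exists>h. homeomorphism {a..b} (g ` {a..b}) g h"
  shows "\<exists>M :: (nat, nat) automaton.
           finite_automaton M \<and>
           is_factor (submetric euclidean_metric {a..b}) g (config_metric M) (step M)"
proof -
  have cont: "continuous_on {a..b} g" and inj: "inj_on g {a..b}"
    using assms(3) by (auto simp: homeomorphism_def intro: inj_on_inverseI)
  define G where "G = g \<circ> g"
  have G_cont: "continuous_on {a..b} G"
    unfolding G_def by (rule continuous_on_compose[OF cont continuous_on_subset[OF cont assms(2)]])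
  have G_into: "G ` {a..b} \<subseteq> {a..b}" using assms(2) by (auto simp: G_def)
  \<comment> \<open>A continuous injection of an interval is strictly monotone, and composing it
    with itself gives an increasing map in either case.\<close>
  have "strict_mono_on {a..b} g \<or> strict_antimono_on {a..b} g"
    using injective_eq_monotone_map[OF is_interval_cc cont] inj by blast
  then have "strict_mono_on {a..b} G"
  proof
    assume "strict_mono_on {a..b} g"
    then show ?thesis using assms(2) unfolding G_def monotone_on_def by (simp add: image_subset_iff)
  next
    assume "strict_antimono_on {a..b} g"
    then show ?thesis using assms(2) unfolding G_def monotone_on_def by (simp add: image_subset_iff)
  qed
  from assms(1) G_cont this G_into show ?thesis
  proof (rule increasing_orbit_coding)
    fix D :: "bool \<Rightarrow> real set" and E :: "bool \<Rightarrow> int \<Rightarrow> real \<Rightarrow> real"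
    assume D: "\<And>r. compact (D r)" "\<And>r. D r \<noteq> {}"
      and E: "\<And>r k. continuous_on (D r) (E r k)"
        "\<And>r k y. y \<in> D r \<Longrightarrow> E r k y \<in> {a..b}"
        "\<And>r k y. y \<in> D r \<Longrightarrow> r \<longrightarrow> 0 \<le> k \<Longrightarrow> E r (k + 1) y = G (E r k y)"
        "\<And>e. 0 < e \<Longrightarrow> \<exists>N. \<forall>r. \<forall>y\<in>D r. \<forall>i j.
           N \<le> i \<and> N \<le> j \<or> i \<le> - N \<and> j \<le> - N \<longrightarrow> \<bar>E r i y - E r j y\<bar> \<le> e"
        "\<And>x. x \<in> {a..b} \<Longrightarrow> \<exists>r k. (r \<longrightarrow> 0 \<le> k) \<and> x \<in> E r k ` D r"
    from orbit_coding_imp_factor[OF cont assms(2) D E(1,2) E(3)[unfolded G_def o_apply] E(4,5)]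
    show ?thesis using finite_automaton_orbit_automaton by blast
  qed
qed

end
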